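(* Suppose $\mathbb{E}O_k\in\mathrm{Ran}(\mathrm{Cov}(O_k))$ for all $k\in\mathbb{T}$. Then the difference equations $$\left\{\begin{array}{l} \widetilde{S}_k=\widetilde{S}_{k+1}\Big[s_k^2-2s_k(\mathbb{E}O_k)^T\widetilde{\mathbb{O}}_k^\dagger\widetilde{\mathbb{L}}_k+\widetilde{\mathbb{L}}_k^T\widetilde{\mathbb{O}}_k^\dagger\,\mathbb{E}(O_kO_k^T)\,\widetilde{\mathbb{O}}_k^\dagger\widetilde{\mathbb{L}}_k\Big],\\ \widetilde{\mathcal{S}}_k=s_k^2\widetilde{\mathcal{S}}_{k+1}-2s_k\widetilde{\mathcal{S}}_{k+1}(\mathbb{E}O_k)^T\widetilde{\mathbb{O}}_k^\dagger\widetilde{\mathbb{L}}_k+\widetilde{\mathbb{L}}_k^T\widetilde{\mathbb{O}}_k^\dagger\widetilde{\mathbb{L}}_k,\\ \widetilde{S}_N=1,\quad\widetilde{\mathcal{S}}_N=0,\\ \widetilde{\mathbb{O}}_k\succeq0,\quad\widetilde{\mathbb{O}}_k\widetilde{\mathbb{O}}_k^\dagger\widetilde{\mathbb{L}}_k=\widetilde{\mathbb{L}}_k,\quad k\in\mathbb{T}, \end{array}\right.$$ and $$\left\{\begin{array}{l} \widetilde{\pi}_k=-\widetilde{\beta}_k\widetilde{\mathbb{O}}_k^\dagger\widetilde{\theta}_k+\big(s_k-(\mathbb{E}O_k)^T\widetilde{\mathbb{O}}_k^\dagger\widetilde{\mathbb{L}}_k\big)\widetilde{\pi}_{k+1},\\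 \widetilde{\pi}_N=-\frac{\mu_2}{2},\\ \widetilde{\mathbb{O}}_k\widetilde{\mathbb{O}}_k^\dagger\widetilde{\theta}_k=\widetilde{\theta}_k,\quad k\in\mathbb{T}, \end{array}\right.$$ are solvable (i.e. the quantities generated by these backward recursions satisfy the constraints $\widetilde{\mathbb{O}}_k\succeq0$, $\widetilde{\mathbb{O}}_k\widetilde{\mathbb{O}}_k^\dagger\widetilde{\mathbb{L}}_k=\widetilde{\mathbb{L}}_k$, $\widetilde{\mathbb{O}}_k\widetilde{\mathbb{O}}_k^\dagger\widetilde{\theta}_k=\widetilde{\theta}_k$ for all $k\in\mathbb{T}$), where, for $k\in\mathbb{T}$, $$\widetilde{\mathbb{O}}_k=\widetilde{\mathcal{S}}_{k+1}\mathbb{E}O_k(\mathbb{E}O_k)^T+\widetilde{S}_{k+1}\mathrm{Cov}(O_k),\quad\widetilde{\mathbb{L}}_k=\big(s_k\widetilde{\mathcal{S}}_{k+1}+\widetilde{U}_{k+1}\big)\mathbb{E}O_k,\quad\widetilde{\theta}_k=\widetilde{\pi}_{k+1}\mathbb{E}O_k,$$ $$\widetilde{U}_k=\big(s_k-(\mathbb{E}O_k)^T\widetilde{\mathbb{O}}_k^\dagger\widetilde{\mathbb{L}}_k\big)\widetilde{U}_{k+1},\quad\widetilde{U}_N=-\tfrac{\mu_1}{2},$$ $$\widetilde{\beta}_k=s_k\widetilde{\mathcal{S}}_{k+1}(\mathbb{E}O_k)^T-\widetilde{\mathbb{L}}_k^T\widetilde{\mathbb{O}}_k^\dagger\big[\widetilde{\mathcal{S}}_{k+1}\mathbb{E}O_k(\mathbb{E}O_k)^T+\widetilde{S}_{k+1}\mathrm{Cov}(O_k)\big];$$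 and for every $t\in\mathbb{T}$ and every $x\in l^2_{\mathcal{F}}(t;\mathbb{R})$, Problem (MV)$_{tx}$ admits a feedback equilibrium strategy $(\Phi^t,v^t)$ with $$\Phi^t=\{-\widetilde{\mathbb{O}}_k^\dagger\widetilde{\mathbb{L}}_k,\ k\in\mathbb{T}_t\},\qquad v^t=\{-\widetilde{\mathbb{O}}_k^\dagger\widetilde{\theta}_k,\ k\in\mathbb{T}_t\}.$$
   Context: Model. $N\ge 1$ and $m\ge 1$ are integers, $\mathbb{T}=\{0,\dots,N-1\}$, $\mathbb{T}_t=\{t,\dots,N-1\}$. For $k\in\mathbb{T}$, $s_k>1$ is a given deterministic number (return of the riskless asset) and $e_k=(e_k^1,\dots,e_k^m)^T$ is an $\mathbb{R}^m$-valued random vector with finite second moments (returns of $m$ risky assets); $e_0,\dots,e_{N-1}$ are independent. $O_k=(e_k^1-s_k,\dots,e_k^m-s_k)^T$ is the excess return vector, and $\mathrm{Cov}(O_k)=\mathrm{Cov}(e_k)=\mathbb{E}[(e_k-\mathbb{E}e_k)(e_k-\mathbb{E}e_k)^T]\succeq0$ (not assumed nonsingular). $\mathcal{F}_k=\sigma(e_\ell,\ \ell=0,\dots,k-1)$ ($\mathcal{F}_0$ trivial) and $\mathbb{E}_t=\mathbb{E}[\,\cdot\,|\mathcal{F}_t]$. $l^2_{\mathcal{F}}(k;\mathbb{R}^d)$ is the set of $\mathcal{F}_k$-measurable square-integrable $\mathbb{R}^d$-valued random variables, and $l^2_{\mathcal{F}}(\mathbb{T}_t;\mathbb{R}^m)$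 is the set of processes $\{\nu_k,k\in\mathbb{T}_t\}$ with $\nu_k\in l^2_{\mathcal{F}}(k;\mathbb{R}^m)$ for each $k\in\mathbb{T}_t$. Problem (MV)$_{tx}$ (multi-period mean-variance problem for the initial pair $(t,x)$, $t\in\mathbb{T}$, $x\in l^2_{\mathcal{F}}(t;\mathbb{R})$): with controls $u\in l^2_{\mathcal{F}}(\mathbb{T}_t;\mathbb{R}^m)$ (short-selling allowed), wealth dynamics $X_{k+1}=s_kX_k+O_k^Tu_k$, $k\in\mathbb{T}_t$, $X_t=x$, and cost $$J(t,x;u)=\mathbb{E}_t(X_N-\mathbb{E}_tX_N)^2-(\mu_1x+\mu_2)\mathbb{E}_tX_N,$$ where $\mu_1,\mu_2>0$ are constants. Feedback strategies. A (admissible) feedback strategy at stage $k$ is a function $f_k(\cdot)$ such that $f_k(\zeta)\in l^2_{\mathcal{F}}(k;\mathbb{R}^m)$ for every $\zeta\in l^2_{\mathcal{F}}(k;\mathbb{R})$; $\mathbb{F}_k$ is the set of these and $\mathbb{F}_{\mathbb{T}_t}=\mathbb{F}_t\times\cdots\times\mathbb{F}_{N-1}$. Feedback equilibrium strategy. $\psi=(\psi_t,\dots,\psi_{N-1})\in\mathbb{F}_{\mathbb{T}_t}$ is a feedback equilibrium strategy of Problem (MV)$_{tx}$ if (a) $\psi$ does not depend on $x$; (b) for every $k\in\mathbb{T}_t$ and $u_k\in l^2_{\mathcal{F}}(k;\mathbb{R}^m)$, $$J\big(k,X_k^{t,x,*};(\psi_k(X_k^{k,\psi}),\dots,\psi_{N-1}(X_{N-1}^{k,\psi}))\big)\le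 J\big(k,X_k^{t,x,*};(u_k,\psi_{k+1}(X_{k+1}^{k,u_k,\psi}),\dots,\psi_{N-1}(X_{N-1}^{k,u_k,\psi}))\big)\quad\text{a.s.},$$ where $X^{t,x,*}_{\ell+1}=s_\ell X^{t,x,*}_\ell+O_\ell^T\psi_\ell(X^{t,x,*}_\ell)$ for $\ell\in\mathbb{T}_t$, $X^{t,x,*}_t=x$; $X^{k,\psi}_{\ell+1}=s_\ell X^{k,\psi}_\ell+O_\ell^T\psi_\ell(X^{k,\psi}_\ell)$ for $\ell\in\mathbb{T}_k$, $X^{k,\psi}_k=X^{t,x,*}_k$; and $X^{k,u_k,\psi}_{\ell+1}=s_\ell X^{k,u_k,\psi}_\ell+O_\ell^T\psi_\ell(X^{k,u_k,\psi}_\ell)$ for $\ell\in\mathbb{T}_{k+1}=\{k+1,\dots,N-1\}$, $X^{k,u_k,\psi}_{k+1}=s_kX^{k,u_k,\psi}_k+O_k^Tu_k$, $X^{k,u_k,\psi}_k=X^{t,x,*}_k$. A pair $(\Psi,\gamma)$, with $\Psi=\{\Psi_k\}$ deterministic vectors in $\mathbb{R}^m$ (acting on scalar states by $\xi\mapsto\Psi_k\xi$) and $\gamma\in l^2_{\mathcal{F}}(\mathbb{T}_t;\mathbb{R}^m)$, both not depending on $x$, is called a (linear) feedback equilibrium strategy if $\psi_k(\xi)=\Psi_k\xi+\gamma_k$, $k\in\mathbb{T}_t$, defines a feedback equilibrium strategy. Notation: $A^\dagger$ is the Moore–Penrose inverse; $\mathrm{Ran}(A)$ the range (column space) of $A$;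 $\succeq0$ means symmetric positive semidefinite. $\widetilde S_k,\widetilde{\mathcal S}_k,\widetilde U_k,\widetilde\pi_k$ are scalars, $\widetilde{\mathbb{O}}_k\in\mathbb{R}^{m\times m}$, $\widetilde{\mathbb{L}}_k,\widetilde\theta_k\in\mathbb{R}^m$ are column vectors, $\widetilde\beta_k$ is a row vector. *)

theory Defs
  imports "HOL-Probability.Probability"
begin

section \<open>Matrices\<close>

definition psd :: "real^'m^'m \<Rightarrow> bool" where
  "psd A \<longleftrightarrow> transpose A = A \<and> (\<forall>v. 0 \<le> v \<bullet> (A *v v))"

definition outer :: "real^'m \<Rightarrow> real^'n \<Rightarrow> real^'n^'m" where
  "outer u v = (\<chi> i j. u $ i * v $ j)"

definition is_moore_penrose :: "real^'n^'m \<Rightarrow> real^'m^'n \<Rightarrow> bool" where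
  "is_moore_penrose A X \<longleftrightarrow>
     A ** X ** A = A \<and> X ** A ** X = X \<and>
     transpose (A ** X) = A ** X \<and> transpose (X ** A) = X ** A"

definition pinv :: "real^'n^'m \<Rightarrow> real^'m^'n" where
  "pinv A = (THE X. is_moore_penrose A X)"

text \<open>The description in \<open>pinv\<close> denotes: every real matrix has exactly one Moore--Penrose inverse.\<close>

lemma moore_penrose_unique:
  assumes "is_moore_penrose A X" "is_moore_penrose A Y"
  shows "X = Y"
proof -
  note a = assms[unfolded is_moore_penrose_def]
  have 1: "A ** X = A ** Y"
  proof -
    have "A ** X = transpose (A ** X)" using a by simp
    also have "\<dots> = transpose ((A ** Y) ** (A ** X))" using a by (simp add: matrix_mul_assoc)
    also have "transpose ((A ** Y) ** (A ** X)) = (A ** X) ** (A ** Y)"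
      using a by (simp only: matrix_transpose_mul)
    also have "\<dots> = A ** Y" using a by (simp add: matrix_mul_assoc)
    finally show ?thesis .
  qed
  have 2: "X ** A = Y ** A"
  proof -
    have l: "X ** A ** (Y ** A) = X ** (A ** Y ** A)" "Y ** A ** (X ** A) = Y ** (A ** X ** A)"
      by (simp_all only: matrix_mul_assoc)
    have "X ** A = transpose (X ** A)" using a by simp
    also have "\<dots> = transpose ((X ** A) ** (Y ** A))" using a by (simp add: l)
    also have "\<dots> = (Y ** A) ** (X ** A)"
      using a by (simp only: matrix_transpose_mul)
    also have "\<dots> = Y ** A" using a by (simp add: l)
    finally show ?thesis .
  qed
  have "X = X ** A ** X" using a by simp
  also have "\<dots> = Y ** (A ** X)" by (simp add: 2 matrix_mul_assoc)
  also have "\<dots> = Y ** A ** Y" by (simp add: 1 matrix_mul_assoc)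
  also have "\<dots> = Y" using a by simp
  finally show ?thesis .
qed

lemma moore_penrose_exists:
  fixes A :: "real^'n^'m"
  shows "\<exists>X. is_moore_penrose A X"
proof -
  let ?f = "\<lambda>x. A *v x"
  let ?K = "{x. A *v x = 0}"
  define P where "P y x \<longleftrightarrow> (\<forall>k\<in>?K. x \<bullet> k = 0) \<and> (\<forall>z. (y - A *v x) \<bullet> (A *v z) = 0)" for y x
  have subK: "subspace ?K"
    by (auto simp: subspace_def matrix_vector_right_distrib matrix_vector_mult_scaleR)
  have subR: "subspace (range ?f)"
    by (rule linear_subspace_image) (simp_all add: subspace_UNIV)
  have spanK: "span ?K = ?K" and spanR: "span (range ?f) = range ?f"
    using subK subR by (simp_all only: span_eq_iff)
  have ex: "\<exists>x. P y x" for y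
  proof -
    obtain r r' where r: "r \<in> span (range ?f)" "\<And>w. w \<in> span (range ?f) \<Longrightarrow> orthogonal r' w"
        "y = r + r'"
      using orthogonal_subspace_decomp_exists[of "range ?f" y] by metis
    from r(1) have "r \<in> range ?f" unfolding spanR .
    then obtain x0 where x0: "r = A *v x0" by (rule rangeE)
    obtain k x where k: "k \<in> span ?K" "\<And>w. w \<in> span ?K \<Longrightarrow> orthogonal x w" "x0 = k + x"
      using orthogonal_subspace_decomp_exists[of ?K x0] by metis
    from k(1) have "A *v k = 0" unfolding spanK by (rule CollectD)
    hence 1: "A *v x = r" using x0 k(3) by (simp add: matrix_vector_right_distrib)
    have 2: "\<forall>k\<in>?K. x \<bullet> k = 0"
    proof
      fix w assume "w \<in> ?K"
      from k(2)[OF span_base[OF this]] show "x \<bullet> w = 0" by (simp only: orthogonal_def)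
    qed
    have 3: "\<forall>z. r' \<bullet> (A *v z) = 0"
    proof
      fix z
      from r(2)[OF span_base[OF rangeI]] show "r' \<bullet> (A *v z) = 0" by (simp only: orthogonal_def)
    qed
    have "y - A *v x = r'" using 1 r(3) by simp
    with 2 3 show ?thesis unfolding P_def by (intro exI[of _ x]) simp
  qed
  have uniq: "x = x'" if "P y x" "P y x'" for y x x'
  proof -
    have "(A *v (x - x')) \<bullet> (A *v (x - x')) = 0"
    proof -
      have "(y - A *v x') \<bullet> (A *v (x - x')) - (y - A *v x) \<bullet> (A *v (x - x')) = 0"
        using that unfolding P_def by simp
      thus ?thesis by (simp add: inner_diff_left matrix_vector_mult_diff_distrib)
    qed
    hence "x - x' \<in> ?K" by simp
    hence "(x - x') \<bullet> (x - x') = 0" using that unfolding P_def by (simp add: inner_diff_left)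
    thus ?thesis by simp
  qed
  define g where "g y = (THE x. P y x)" for y
  have g: "P y (g y)" for y
    unfolding g_def using ex uniq by (metis theI)
  have gI: "g y = x" if "P y x" for y x using uniq[OF g that] .
  have "linear g"
  proof (rule linearI)
    fix a b show "g (a + b) = g a + g b"
      by (rule gI) (use g[of a] g[of b] in
          \<open>auto simp: P_def inner_add_left inner_diff_left matrix_vector_right_distrib\<close>)
  next
    fix c :: real and a show "g (c *\<^sub>R a) = c *\<^sub>R g a"
      by (rule gI) (use g[of a] in
          \<open>auto simp: P_def inner_diff_left matrix_vector_mult_scaleR\<close>)
  qed
  define X where "X = matrix g"
  have X: "X *v y = g y" for y unfolding X_def using \<open>linear g\<close> by (simp add: matrix_works)
  have o1: "(y - A *v (X *v y)) \<bullet> (A *v z) = 0" for y z using g[of y] X unfolding P_def by auto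
  have o2: "(X *v y) \<bullet> k = 0" if "A *v k = 0" for y k using g[of y] X that unfolding P_def by auto
  have AXA: "A *v (X *v (A *v z)) = A *v z" for z
  proof -
    have "(A *v z - A *v (X *v (A *v z))) \<bullet> (A *v (z - X *v (A *v z))) = 0" by (rule o1)
    thus ?thesis by (simp add: matrix_vector_mult_diff_distrib)
  qed
  have XAX: "X *v (A *v (X *v y)) = X *v y" for y
  proof -
    have "P (A *v (X *v y)) (X *v y)" unfolding P_def using o2 by auto
    thus ?thesis using gI X by metis
  qed
  have sym: "transpose B = B" if "\<And>u v. (B *v u) \<bullet> v = u \<bullet> (B *v v)" for B :: "real^'k^'k"
  proof -
    have "u \<bullet> (transpose B *v v) = u \<bullet> (B *v v)" for u v
      using that[of u v] by (metis dot_lmul_matrix inner_commute transpose_matrix_vector)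
    hence "transpose B *v v = B *v v" for v by (metis vector_eq_rdot inner_commute)
    thus ?thesis by (simp add: matrix_eq)
  qed
  have s1: "transpose (A ** X) = A ** X"
  proof (rule sym)
    fix u v
    have "(A *v (X *v u)) \<bullet> v = (A *v (X *v u)) \<bullet> (A *v (X *v v))"
      using o1[of v "X *v u"] by (simp add: inner_diff_left inner_diff_right inner_commute)
    moreover have "u \<bullet> (A *v (X *v v)) = (A *v (X *v u)) \<bullet> (A *v (X *v v))"
      using o1[of u "X *v v"] by (simp add: inner_diff_left)
    ultimately show "((A ** X) *v u) \<bullet> v = u \<bullet> ((A ** X) *v v)"
      by (simp add: matrix_vector_mul_assoc[symmetric])
  qed
  have s2: "transpose (X ** A) = X ** A"
  proof (rule sym)
    fix u v
    have z: "A *v (w - X *v (A *v w)) = 0" for w by (simp add: matrix_vector_mult_diff_distrib AXA)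
    have "(X *v (A *v u)) \<bullet> v = (X *v (A *v u)) \<bullet> (X *v (A *v v))"
      using o2[OF z[of v], of "A *v u"] by (simp add: inner_diff_right)
    moreover have "u \<bullet> (X *v (A *v v)) = (X *v (A *v u)) \<bullet> (X *v (A *v v))"
      using o2[OF z[of u], of "A *v v"] by (simp add: inner_diff_right inner_commute)
    ultimately show "((X ** A) *v u) \<bullet> v = u \<bullet> ((X ** A) *v v)"
      by (simp add: matrix_vector_mul_assoc[symmetric])
  qed
  have "is_moore_penrose A X"
    unfolding is_moore_penrose_def using s1 s2
    by (auto simp: matrix_eq matrix_vector_mul_assoc[symmetric] AXA XAX)
  thus ?thesis ..
qed

lemma is_moore_penrose_pinv: "is_moore_penrose A (pinv A)"
  unfolding pinv_def using moore_penrose_exists moore_penrose_unique by (metis theI)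


section \<open>Market\<close>

text \<open>Throughout, \<open>M\<close> is the underlying probability space, \<open>s k\<close> and \<open>e k\<close> are the riskless and
  risky returns of period \<open>k\<close>, and the periods are \<open>k < N\<close>.\<close>

definition excess :: "(nat \<Rightarrow> real) \<Rightarrow> (nat \<Rightarrow> 'a \<Rightarrow> real^'m) \<Rightarrow> nat \<Rightarrow> 'a \<Rightarrow> real^'m" where
  "excess s e k \<omega> = (\<chi> i. e k \<omega> $ i - s k)"

definition mean_excess ::
  "'a measure \<Rightarrow> (nat \<Rightarrow> real) \<Rightarrow> (nat \<Rightarrow> 'a \<Rightarrow> real^'m) \<Rightarrow> nat \<Rightarrow> real^'m" where
  "mean_excess M s e k = (\<integral>\<omega>. excess s e k \<omega> \<partial>M)"

definition second_moment_excess ::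
  "'a measure \<Rightarrow> (nat \<Rightarrow> real) \<Rightarrow> (nat \<Rightarrow> 'a \<Rightarrow> real^'m) \<Rightarrow> nat \<Rightarrow> real^'m^'m" where
  "second_moment_excess M s e k = (\<integral>\<omega>. outer (excess s e k \<omega>) (excess s e k \<omega>) \<partial>M)"

definition cov_excess ::
  "'a measure \<Rightarrow> (nat \<Rightarrow> real) \<Rightarrow> (nat \<Rightarrow> 'a \<Rightarrow> real^'m) \<Rightarrow> nat \<Rightarrow> real^'m^'m" where
  "cov_excess M s e k =
     (\<integral>\<omega>. outer (excess s e k \<omega> - mean_excess M s e k) (excess s e k \<omega> - mean_excess M s e k) \<partial>M)"

text \<open>\<open>\<F>\<^sub>k = \<sigma>(e\<^sub>l, l < k)\<close>.  It is written with \<open>sigma\<close> rather than as a supremum of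
  \<open>vimage_algebra\<close>s because the empty supremum has empty space, whereas \<open>\<F>\<^sub>0\<close> has to be the
  trivial \<sigma>-algebra on \<open>space M\<close>.\<close>

definition filt :: "'a measure \<Rightarrow> (nat \<Rightarrow> 'a \<Rightarrow> real^'m) \<Rightarrow> nat \<Rightarrow> 'a measure" where
  "filt M e k = sigma (space M) (\<Union>l<k. {e l -` A \<inter> space M | A. A \<in> sets borel})"

definition l2F :: "'a measure \<Rightarrow> (nat \<Rightarrow> 'a \<Rightarrow> real^'m) \<Rightarrow> nat \<Rightarrow> ('a \<Rightarrow> 'b::euclidean_space) set"
  where
  "l2F M e k = {f. f \<in> borel_measurable (filt M e k) \<and> integrable M (\<lambda>\<omega>. (norm (f \<omega>))\<^sup>2)}"

definition l2F_process ::
  "'a measure \<Rightarrow> nat \<Rightarrow> (nat \<Rightarrow> 'a \<Rightarrow> real^'m) \<Rightarrow> nat \<Rightarrow> (nat \<Rightarrow> 'a \<Rightarrow> 'b::euclidean_space) set" where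
  "l2F_process M N e t = {u. \<forall>k\<in>{t..<N}. u k \<in> l2F M e k}"


section \<open>The mean-variance problem and feedback equilibria\<close>

text \<open>Wealth started from \<open>x\<close> at time \<open>t\<close>: the value at \<open>k \<le> t\<close> is \<open>x\<close>, only \<open>k \<ge> t\<close> is meaningful.\<close>

primrec wealth ::
  "(nat \<Rightarrow> real) \<Rightarrow> (nat \<Rightarrow> 'a \<Rightarrow> real^'m) \<Rightarrow> nat \<Rightarrow> ('a \<Rightarrow> real) \<Rightarrow> (nat \<Rightarrow> 'a \<Rightarrow> real^'m)
     \<Rightarrow> nat \<Rightarrow> 'a \<Rightarrow> real" where
  "wealth s e t x u 0 = x"
| "wealth s e t x u (Suc k) =
     (if k < t then x
      else (\<lambda>\<omega>. s k * wealth s e t x u k \<omega> + excess s e k \<omega> \<bullet> u k \<omega>))"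

definition cost ::
  "'a measure \<Rightarrow> nat \<Rightarrow> (nat \<Rightarrow> real) \<Rightarrow> (nat \<Rightarrow> 'a \<Rightarrow> real^'m) \<Rightarrow> real \<Rightarrow> real
     \<Rightarrow> nat \<Rightarrow> ('a \<Rightarrow> real) \<Rightarrow> (nat \<Rightarrow> 'a \<Rightarrow> real^'m) \<Rightarrow> 'a \<Rightarrow> real" where
  "cost M N s e \<mu>1 \<mu>2 t x u \<omega> =
     (let XN = wealth s e t x u N;
          EXN = real_cond_exp M (filt M e t) XN
      in real_cond_exp M (filt M e t) (\<lambda>\<omega>'. (XN \<omega>' - EXN \<omega>')\<^sup>2) \<omega> - (\<mu>1 * x \<omega> + \<mu>2) * EXN \<omega>)"

type_synonym ('a, 'm) strategy = "nat \<Rightarrow> ('a \<Rightarrow> real) \<Rightarrow> 'a \<Rightarrow> real^'m"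

definition feedback_strategies ::
  "'a measure \<Rightarrow> nat \<Rightarrow> (nat \<Rightarrow> 'a \<Rightarrow> real^'m) \<Rightarrow> nat \<Rightarrow> ('a, 'm) strategy set" where
  "feedback_strategies M N e t = {\<psi>. \<forall>k\<in>{t..<N}. \<forall>\<zeta>\<in>l2F M e k. \<psi> k \<zeta> \<in> l2F M e k}"

primrec closed_wealth ::
  "(nat \<Rightarrow> real) \<Rightarrow> (nat \<Rightarrow> 'a \<Rightarrow> real^'m) \<Rightarrow> nat \<Rightarrow> ('a \<Rightarrow> real) \<Rightarrow> ('a, 'm::finite) strategy
     \<Rightarrow> nat \<Rightarrow> 'a \<Rightarrow> real" where
  "closed_wealth s e t x \<psi> 0 = x"
| "closed_wealth s e t x \<psi> (Suc k) =
     (if k < t then x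
      else (\<lambda>\<omega>. s k * closed_wealth s e t x \<psi> k \<omega>
                 + excess s e k \<omega> \<bullet> \<psi> k (closed_wealth s e t x \<psi> k) \<omega>))"

definition closed_control ::
  "(nat \<Rightarrow> real) \<Rightarrow> (nat \<Rightarrow> 'a \<Rightarrow> real^'m) \<Rightarrow> nat \<Rightarrow> ('a \<Rightarrow> real) \<Rightarrow> ('a, 'm::finite) strategy
     \<Rightarrow> nat \<Rightarrow> 'a \<Rightarrow> real^'m" where
  "closed_control s e t x \<psi> k = \<psi> k (closed_wealth s e t x \<psi> k)"

text \<open>A candidate equilibrium is a rule \<open>\<psi>\<close> that assigns a strategy to every initial state, so that
  the requirement that the strategy does not depend on \<open>x\<close> can be stated.  The one-stage deviation
  to \<open>u\<close> at stage \<open>k\<close> is the strategy \<open>\<psi> x\<close> with stage \<open>k\<close> replaced by the constant map \<open>\<lambda>_. u\<close>; its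
  closed-loop control from \<open>k\<close> on is \<open>u\<close> followed by the feedback of \<open>\<psi> x\<close> on the deviated wealth.\<close>

definition feedback_equilibrium ::
  "'a measure \<Rightarrow> nat \<Rightarrow> (nat \<Rightarrow> real) \<Rightarrow> (nat \<Rightarrow> 'a \<Rightarrow> real^'m) \<Rightarrow> real \<Rightarrow> real
     \<Rightarrow> nat \<Rightarrow> ('a \<Rightarrow> real) \<Rightarrow> (('a \<Rightarrow> real) \<Rightarrow> ('a, 'm::finite) strategy) \<Rightarrow> bool" where
  "feedback_equilibrium M N s e \<mu>1 \<mu>2 t x \<psi> \<longleftrightarrow>
     \<psi> x \<in> feedback_strategies M N e t \<and>
     (\<forall>y\<in>l2F M e t. \<forall>k\<in>{t..<N}. \<psi> y k = \<psi> x k) \<and>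
     (\<forall>k\<in>{t..<N}. \<forall>u\<in>l2F M e k.
        let \<xi> = closed_wealth s e t x (\<psi> x) k in
        AE \<omega> in M.
          cost M N s e \<mu>1 \<mu>2 k \<xi> (closed_control s e k \<xi> (\<psi> x)) \<omega>
          \<le> cost M N s e \<mu>1 \<mu>2 k \<xi> (closed_control s e k \<xi> ((\<psi> x)(k := \<lambda>_. u))) \<omega>)"

definition linear_feedback_equilibrium ::
  "'a measure \<Rightarrow> nat \<Rightarrow> (nat \<Rightarrow> real) \<Rightarrow> (nat \<Rightarrow> 'a \<Rightarrow> real^'m) \<Rightarrow> real \<Rightarrow> real
     \<Rightarrow> nat \<Rightarrow> ('a \<Rightarrow> real) \<Rightarrow> (('a \<Rightarrow> real) \<Rightarrow> nat \<Rightarrow> real^'m)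
     \<Rightarrow> (('a \<Rightarrow> real) \<Rightarrow> nat \<Rightarrow> 'a \<Rightarrow> real^'m::finite) \<Rightarrow> bool" where
  "linear_feedback_equilibrium M N s e \<mu>1 \<mu>2 t x \<Psi> \<gamma> \<longleftrightarrow>
     \<gamma> x \<in> l2F_process M N e t \<and>
     (\<forall>y\<in>l2F M e t. \<forall>k\<in>{t..<N}. \<Psi> y k = \<Psi> x k \<and> \<gamma> y k = \<gamma> x k) \<and>
     feedback_equilibrium M N s e \<mu>1 \<mu>2 t x (\<lambda>y k \<xi> \<omega>. \<xi> \<omega> *\<^sub>R \<Psi> y k + \<gamma> y k \<omega>)"


section \<open>The difference equations\<close>

text \<open>The sequences \<open>S\<close>, \<open>Sc\<close>, \<open>U\<close>, \<open>p\<close> stand for \<open>S\<close>, calligraphic \<open>S\<close>, \<open>U\<close> and \<open>\<pi>\<close> (all with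
  tilde); \<open>bbO\<close>, \<open>bbL\<close>, \<open>\<theta>\<close>, \<open>\<beta>\<close> below are the quantities derived from them.  The row vector
  \<open>\<beta>\<close> is represented by the vector of its entries.\<close>

definition bbO ::
  "'a measure \<Rightarrow> (nat \<Rightarrow> real) \<Rightarrow> (nat \<Rightarrow> 'a \<Rightarrow> real^'m)
     \<Rightarrow> (nat \<Rightarrow> real) \<Rightarrow> (nat \<Rightarrow> real) \<Rightarrow> nat \<Rightarrow> real^'m^'m" where
  "bbO M s e S Sc k =
     Sc (k + 1) *\<^sub>R outer (mean_excess M s e k) (mean_excess M s e k)
     + S (k + 1) *\<^sub>R cov_excess M s e k"

definition bbL ::
  "'a measure \<Rightarrow> (nat \<Rightarrow> real) \<Rightarrow> (nat \<Rightarrow> 'a \<Rightarrow> real^'m)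
     \<Rightarrow> (nat \<Rightarrow> real) \<Rightarrow> (nat \<Rightarrow> real) \<Rightarrow> nat \<Rightarrow> real^'m" where
  "bbL M s e Sc U k = (s k * Sc (k + 1) + U (k + 1)) *\<^sub>R mean_excess M s e k"

definition \<theta> ::
  "'a measure \<Rightarrow> (nat \<Rightarrow> real) \<Rightarrow> (nat \<Rightarrow> 'a \<Rightarrow> real^'m)
     \<Rightarrow> (nat \<Rightarrow> real) \<Rightarrow> nat \<Rightarrow> real^'m" where
  "\<theta> M s e p k = p (k + 1) *\<^sub>R mean_excess M s e k"

definition \<beta> ::
  "'a measure \<Rightarrow> (nat \<Rightarrow> real) \<Rightarrow> (nat \<Rightarrow> 'a \<Rightarrow> real^'m)
     \<Rightarrow> (nat \<Rightarrow> real) \<Rightarrow> (nat \<Rightarrow> real) \<Rightarrow> (nat \<Rightarrow> real) \<Rightarrow> nat \<Rightarrow> real^'m" where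
  "\<beta> M s e S Sc U k =
     (s k * Sc (k + 1)) *\<^sub>R mean_excess M s e k
     - bbL M s e Sc U k v*
         (pinv (bbO M s e S Sc k) **
          (Sc (k + 1) *\<^sub>R outer (mean_excess M s e k) (mean_excess M s e k)
           + S (k + 1) *\<^sub>R cov_excess M s e k))"

text \<open>The recursion for \<open>U\<close> is listed here because \<open>bbL\<close>, and hence this system, depends on it.\<close>

definition solves_S_equations ::
  "'a measure \<Rightarrow> nat \<Rightarrow> (nat \<Rightarrow> real) \<Rightarrow> (nat \<Rightarrow> 'a \<Rightarrow> real^'m) \<Rightarrow> real
     \<Rightarrow> (nat \<Rightarrow> real) \<Rightarrow> (nat \<Rightarrow> real) \<Rightarrow> (nat \<Rightarrow> real) \<Rightarrow> bool" where
  "solves_S_equations M N s e \<mu>1 S Sc U \<longleftrightarrow>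
     (\<forall>k<N.
        let EO = mean_excess M s e k;
            E2 = second_moment_excess M s e k;
            Om = bbO M s e S Sc k;
            L = bbL M s e Sc U k
        in S k = S (k + 1) *
                   ((s k)\<^sup>2 - 2 * s k * (EO \<bullet> (pinv Om *v L))
                    + L \<bullet> ((pinv Om ** E2 ** pinv Om) *v L)) \<and>
           Sc k = (s k)\<^sup>2 * Sc (k + 1) - 2 * s k * Sc (k + 1) * (EO \<bullet> (pinv Om *v L))
                    + L \<bullet> (pinv Om *v L) \<and>
           U k = (s k - EO \<bullet> (pinv Om *v L)) * U (k + 1) \<and>
           psd Om \<and>
           (Om ** pinv Om) *v L = L) \<and>
     S N = 1 \<and> Sc N = 0 \<and> U N = - \<mu>1 / 2"

definition solves_\<pi>_equations ::
  "'a measure \<Rightarrow> nat \<Rightarrow> (nat \<Rightarrow> real) \<Rightarrow> (nat \<Rightarrow> 'a \<Rightarrow> real^'m) \<Rightarrow> real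
     \<Rightarrow> (nat \<Rightarrow> real) \<Rightarrow> (nat \<Rightarrow> real) \<Rightarrow> (nat \<Rightarrow> real) \<Rightarrow> (nat \<Rightarrow> real) \<Rightarrow> bool" where
  "solves_\<pi>_equations M N s e \<mu>2 S Sc U p \<longleftrightarrow>
     (\<forall>k<N.
        let EO = mean_excess M s e k;
            Om = bbO M s e S Sc k;
            L = bbL M s e Sc U k;
            th = \<theta> M s e p k
        in p k = - (\<beta> M s e S Sc U k \<bullet> (pinv Om *v th)) + (s k - EO \<bullet> (pinv Om *v L)) * p (k + 1) \<and>
           (Om ** pinv Om) *v th = th) \<and>
     p N = - \<mu>2 / 2"

end

theory Submission
  imports Defs
begin

text \<open>Under an affine feedback with deterministic coefficients, terminal wealth is \<open>A y + B\<close> in the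
  current wealth \<open>y\<close>, where \<open>A\<close> and \<open>B\<close> depend only on future returns.  The sequences of the
  difference equations are moments of this pair:
  \<open>S = E A\<^sup>2\<close>, \<open>Sc = Var A\<close>, \<open>U = - \<mu>1 / 2 * E A\<close> and \<open>p = Cov A B - \<mu>2 / 2 * E A\<close>.  Consequently
  the cost of deviating to \<open>u\<close> at stage \<open>k\<close> from wealth \<open>\<xi>\<close> is, up to terms without \<open>u\<close>, the quadratic
  \<open>u \<bullet> bbO u + 2 u \<bullet> (\<xi> bbL + \<theta>)\<close>, which the proposed feedback minimizes because \<open>bbO\<close> is positive
  semidefinite and has \<open>bbL\<close> and \<open>\<theta>\<close> in its range.  For solvability, \<open>S > 0\<close> and \<open>Sc \<ge> 0\<close> propagate
  backwards, and they put the mean excess return in the range of \<open>bbO\<close> since it lies in that of the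
  covariance.\<close>

section \<open>Positive semidefinite matrices\<close>

lemma matrix_vector_mult_minus: "A *v (- z) = - (A *v z)" for A :: "real^'n^'k"
  using matrix_vector_mult_scaleR[of A "-1" z] by simp

lemma outer_mult_vec: "outer u v *v w = (v \<bullet> w) *\<^sub>R u"
  by (simp add: outer_def matrix_vector_mult_def vec_eq_iff inner_vec_def sum_distrib_left
      sum_distrib_right mult_ac)

lemma symmetric_inner_commute:
  fixes A :: "real^'n^'n"
  assumes "transpose A = A"
  shows "u \<bullet> (A *v v) = v \<bullet> (A *v u)"
  using assms by (metis dot_lmul_matrix inner_commute transpose_matrix_vector)

lemma psd_inner_commute: "psd A \<Longrightarrow> u \<bullet> (A *v v) = v \<bullet> (A *v u)"
  by (simp add: psd_def symmetric_inner_commute)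

text \<open>Perturb \<open>v\<close> along \<open>A *v v\<close>. The quadratic form on this line
  has no constant term, so its linear coefficient must vanish; otherwise a small negative step would
  make it negative.\<close>

lemma psd_null:
  assumes "psd A" "v \<bullet> (A *v v) = 0"
  shows "A *v v = 0"
proof -
  let ?w = "A *v v"
  have q: "0 \<le> 2 * r * (?w \<bullet> ?w) + r\<^sup>2 * (?w \<bullet> (A *v ?w))" for r
  proof -
    have "0 \<le> (v + r *\<^sub>R ?w) \<bullet> (A *v (v + r *\<^sub>R ?w))"
      using assms(1) by (simp add: psd_def)
    also have "\<dots> = 2 * r * (?w \<bullet> ?w) + r\<^sup>2 * (?w \<bullet> (A *v ?w))"
      using assms(2) psd_inner_commute[OF assms(1), of v ?w]
      by (simp add: matrix_vector_right_distrib matrix_vector_mult_scaleR inner_add_left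
          inner_add_right power2_eq_square algebra_simps)
    finally show ?thesis .
  qed
  define c where "c = ?w \<bullet> (A *v ?w)"
  have "c \<ge> 0" using assms(1) by (simp add: psd_def c_def)
  show ?thesis
  proof (rule ccontr)
    assume "?w \<noteq> 0"
    then have n: "?w \<bullet> ?w > 0" by simp
    \<comment> \<open>The step is small enough that \<open>d * c\<close> stays below
      \<open>?w \<bullet> ?w\<close>, and the \<open>+ 1\<close> keeps the denominator positive when
      \<open>c = 0\<close>.\<close>
    define d where "d = (?w \<bullet> ?w) / (c + 1)"
    have d: "d > 0" using n \<open>c \<ge> 0\<close> by (simp add: d_def)
    have "0 \<le> 2 * (- d) * (?w \<bullet> ?w) + (- d)\<^sup>2 * c" using q[of "- d"] by (simp add: c_def)
    then have "0 \<le> d * (d * c - 2 * (?w \<bullet> ?w))" by (simp add: power2_eq_square algebra_simps)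
    then have "2 * (?w \<bullet> ?w) \<le> d * c" using d by (simp add: zero_le_mult_iff)
    moreover have "d * c \<le> ?w \<bullet> ?w"
      using n \<open>c \<ge> 0\<close> by (simp add: d_def field_simps)
    ultimately show False using n by linarith
  qed
qed

text \<open>Completing the square: once \<open>w\<close> is replaced by \<open>- (A *v v)\<close>,
  the right side minus the left side is the form of \<open>A\<close> at \<open>u - v\<close>. No
  invertibility of \<open>A\<close> enters, only a solution \<open>v\<close> of the first-order
  condition.\<close>

lemma psd_quadratic_min:
  assumes "psd A" "A *v v = - w"
  shows "v \<bullet> (A *v v) + 2 * (v \<bullet> w) \<le> u \<bullet> (A *v u) + 2 * (u \<bullet> w)"
proof -
  have "0 \<le> (u - v) \<bullet> (A *v (u - v))" using assms(1) by (simp add: psd_def)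
  also have "\<dots> = u \<bullet> (A *v u) + 2 * (u \<bullet> w) - (v \<bullet> (A *v v) + 2 * (v \<bullet> w))"
    using psd_inner_commute[OF assms(1), of v u] assms(2)
    by (simp add: matrix_vector_mult_diff_distrib inner_diff_left inner_diff_right algebra_simps)
  finally show ?thesis by simp
qed

text \<open>For symmetric \<open>A\<close>, transposing the Penrose equations exchanges
  \<open>A ** X\<close> with \<open>X ** A\<close>, so the transpose of \<open>pinv A\<close>
  satisfies them as well and uniqueness applies.\<close>

lemma transpose_pinv:
  assumes "transpose A = A"
  shows "transpose (pinv A) = pinv A"
proof (rule moore_penrose_unique)
  note p = is_moore_penrose_pinv[of A, unfolded is_moore_penrose_def]
  have t: "pinv A ** A = A ** transpose (pinv A)" "A ** pinv A = transpose (pinv A) ** A"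
    using p by (simp_all add: matrix_transpose_mul assms)
  have "A ** transpose (pinv A) ** A = transpose (A ** pinv A ** A)"
    and "transpose (pinv A) ** A ** transpose (pinv A) = transpose (pinv A ** A ** pinv A)"
    by (simp_all add: matrix_transpose_mul assms matrix_mul_assoc)
  then show "is_moore_penrose A (transpose (pinv A))"
    unfolding is_moore_penrose_def using p t by (simp add: assms)
qed (rule is_moore_penrose_pinv)

lemma mult_pinv_range:
  assumes "v = A *v w"
  shows "A *v (pinv A *v v) = v"
  using is_moore_penrose_pinv[of A] assms
  by (simp add: is_moore_penrose_def matrix_vector_mul_assoc matrix_mul_assoc)

lemma psd_rank_one_update:
  assumes "psd C" "0 \<le> c" "0 \<le> d"
  shows "psd (c *\<^sub>R outer m m + d *\<^sub>R C)"
proof -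
  have "transpose (c *\<^sub>R outer m m + d *\<^sub>R C) = c *\<^sub>R outer m m + d *\<^sub>R C"
    using assms(1) by (simp add: psd_def transpose_def outer_def vec_eq_iff mult_ac)
  moreover have "0 \<le> v \<bullet> ((c *\<^sub>R outer m m + d *\<^sub>R C) *v v)" for v
    using assms by (simp add: psd_def matrix_vector_mult_add_rdistrib scaleR_matrix_vector_assoc[symmetric]
      outer_mult_vec inner_add_right inner_commute[of v m] mult.assoc)
  ultimately show ?thesis by (simp add: psd_def)
qed

text \<open>The updated matrix sends \<open>w\<close> to a multiple of \<open>m\<close>. The factor
  \<open>c * (m \<bullet> w) + d\<close> is positive because \<open>m \<bullet> w\<close> is the
  form of \<open>C\<close> at \<open>w\<close>, so rescaling \<open>w\<close> gives a preimage of
  \<open>m\<close>.\<close>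

lemma rank_one_update_range:
  assumes "psd C" "0 \<le> c" "0 < d" "m = C *v w"
  shows "\<exists>v. m = (c *\<^sub>R outer m m + d *\<^sub>R C) *v v"
proof -
  have "0 \<le> m \<bullet> w" using assms(1,4) by (simp add: psd_def inner_commute)
  then have "c * (m \<bullet> w) + d > 0" using assms(2,3) by (simp add: add_nonneg_pos)
  moreover have "(c *\<^sub>R outer m m + d *\<^sub>R C) *v w = (c * (m \<bullet> w) + d) *\<^sub>R m"
    using assms(4) by (simp add: matrix_vector_mult_add_rdistrib scaleR_matrix_vector_assoc[symmetric]
      outer_mult_vec scaleR_left_distrib)
  ultimately have "m = (c *\<^sub>R outer m m + d *\<^sub>R C) *v ((1 / (c * (m \<bullet> w) + d)) *\<^sub>R w)"
    by (simp add: matrix_vector_mult_scaleR)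
  then show ?thesis ..
qed

text \<open>The domination behind every claim that a product of square-integrable functions is
  integrable.\<close>

lemma abs_mult_le_sum_squares: "\<bar>a * b\<bar> \<le> a\<^sup>2 + b\<^sup>2" for a b :: real
  using sum_squares_bound[of "\<bar>a\<bar>" "\<bar>b\<bar>"] mult_nonneg_nonneg[of "\<bar>a\<bar>" "\<bar>b\<bar>"]
  unfolding abs_mult power2_abs by linarith

lemma backward_recursion:
  "\<exists>a. a N = z \<and> (\<forall>k<N. a k = f k (a (Suc k)))" for N :: nat
proof -
  \<comment> \<open>Time reversal: \<open>r n\<close> is the value \<open>n\<close> steps before the
    horizon, so passing from \<open>n\<close> to \<open>Suc n\<close> uses the stage
    \<open>N - Suc n\<close>.\<close>
  define r where "r = rec_nat z (\<lambda>n. f (N - Suc n))"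
  have "r (N - k) = f k (r (N - Suc k))" if "k < N" for k
  proof -
    have "N - k = Suc (N - Suc k)" using that by simp
    moreover have "N - Suc (N - Suc k) = k" using that by simp
    ultimately show ?thesis by (simp add: r_def)
  qed
  then show ?thesis by (intro exI[of _ "\<lambda>k. r (N - k)"]) (simp add: r_def)
qed

section \<open>Conditional expectations\<close>

text \<open>An explicit version \<open>g\<close> of the conditional expectation is carried together
  with both integrability facts. The closure rules below can then be chained without collecting side
  conditions again.\<close>

definition has_cond_exp :: "'a measure \<Rightarrow> 'a measure \<Rightarrow> ('a \<Rightarrow> real) \<Rightarrow> ('a \<Rightarrow> real) \<Rightarrow> bool" where
  "has_cond_exp M F f g \<longleftrightarrow> integrable M f \<and> integrable M g \<and> g \<in> borel_measurable F \<and>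
     (AE \<omega> in M. real_cond_exp M F f \<omega> = g \<omega>)"

context sigma_finite_subalgebra
begin

lemma has_cond_exp_add:
  assumes "has_cond_exp M F f g" "has_cond_exp M F f' g'"
  shows "has_cond_exp M F (\<lambda>\<omega>. f \<omega> + f' \<omega>) (\<lambda>\<omega>. g \<omega> + g' \<omega>)"
  using assms real_cond_exp_add[of f f'] unfolding has_cond_exp_def by auto

lemma has_cond_exp_cmult:
  assumes "has_cond_exp M F f g"
  shows "has_cond_exp M F (\<lambda>\<omega>. c * f \<omega>) (\<lambda>\<omega>. c * g \<omega>)"
  using assms real_cond_exp_cmult[of f c] unfolding has_cond_exp_def by fastforce

lemma has_cond_exp_F_meas:
  assumes "integrable M f" "f \<in> borel_measurable F"
  shows "has_cond_exp M F f f"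
  using assms unfolding has_cond_exp_def by auto

lemma has_cond_exp_sum:
  assumes "finite I" "\<And>i. i \<in> I \<Longrightarrow> has_cond_exp M F (f i) (g i)"
  shows "has_cond_exp M F (\<lambda>\<omega>. \<Sum>i\<in>I. f i \<omega>) (\<lambda>\<omega>. \<Sum>i\<in>I. g i \<omega>)"
  using assms
proof (induction I rule: finite_induct)
  case empty
  then show ?case using has_cond_exp_F_meas[of "\<lambda>_. 0"] by simp
next
  case (insert i I)
  then show ?case using has_cond_exp_add[of "f i" "g i"] by simp
qed

lemma has_cond_exp_mult:
  assumes "has_cond_exp M F f g" "w \<in> borel_measurable F" "integrable M (\<lambda>\<omega>. w \<omega> * f \<omega>)"
    "integrable M (\<lambda>\<omega>. w \<omega> * g \<omega>)"
  shows "has_cond_exp M F (\<lambda>\<omega>. w \<omega> * f \<omega>) (\<lambda>\<omega>. w \<omega> * g \<omega>)"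
proof -
  have "AE \<omega> in M. real_cond_exp M F (\<lambda>\<omega>. w \<omega> * f \<omega>) \<omega> = w \<omega> * real_cond_exp M F f \<omega>"
    using assms by (intro real_cond_exp_mult) (auto simp: has_cond_exp_def)
  then show ?thesis using assms unfolding has_cond_exp_def by auto
qed

lemma has_cond_exp_tower:
  assumes "subalgebra M G" "subalgebra G F" "has_cond_exp M G f g" "has_cond_exp M F g h"
  shows "has_cond_exp M F f h"
proof -
  have "AE \<omega> in M. real_cond_exp M F (real_cond_exp M G f) \<omega> = real_cond_exp M F f \<omega>"
    using assms by (intro real_cond_exp_nested_subalg) (auto simp: has_cond_exp_def)
  moreover have "AE \<omega> in M. real_cond_exp M F (real_cond_exp M G f) \<omega> = real_cond_exp M F g \<omega>"
    using assms by (intro real_cond_exp_cong) (auto simp: has_cond_exp_def)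
  ultimately show ?thesis using assms(3,4) unfolding has_cond_exp_def by auto
qed

text \<open>After the conditional mean is replaced by its version \<open>g\<close>, the square is
  expanded. Pulling \<open>g\<close> out of the cross term turns it into \<open>-2 * g * g\<close>,
  which together with \<open>g\<^sup>2\<close> leaves \<open>- g\<^sup>2\<close>.\<close>

lemma cond_variance:
  assumes "has_cond_exp M F f g" "has_cond_exp M F (\<lambda>\<omega>. (f \<omega>)\<^sup>2) h" "integrable M (\<lambda>\<omega>. (g \<omega>)\<^sup>2)"
  shows "AE \<omega> in M. real_cond_exp M F (\<lambda>\<omega>'. (f \<omega>' - real_cond_exp M F f \<omega>')\<^sup>2) \<omega> = h \<omega> - (g \<omega>)\<^sup>2"
proof -
  have F[measurable]: "g \<in> borel_measurable F" "f \<in> borel_measurable M" "g \<in> borel_measurable M"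
    using assms(1) by (auto simp: has_cond_exp_def)
  have fg: "integrable M (\<lambda>\<omega>. g \<omega> * f \<omega>)"
  proof (rule Bochner_Integration.integrable_bound)
    show "integrable M (\<lambda>\<omega>. (g \<omega>)\<^sup>2 + (f \<omega>)\<^sup>2)"
      using assms by (auto simp: has_cond_exp_def)
    show "AE \<omega> in M. norm (g \<omega> * f \<omega>) \<le> norm ((g \<omega>)\<^sup>2 + (f \<omega>)\<^sup>2)"
      by (simp add: abs_mult_le_sum_squares)
  qed simp
  have "has_cond_exp M F (\<lambda>\<omega>. g \<omega> * f \<omega>) (\<lambda>\<omega>. g \<omega> * g \<omega>)"
    using assms fg by (intro has_cond_exp_mult) (simp_all add: power2_eq_square)
  from has_cond_exp_add[OF has_cond_exp_add[OF assms(2) has_cond_exp_cmult[OF this, of "-2"]]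
      has_cond_exp_F_meas[OF assms(3)]]
  have "has_cond_exp M F (\<lambda>\<omega>. (f \<omega> - g \<omega>)\<^sup>2) (\<lambda>\<omega>. h \<omega> - (g \<omega>)\<^sup>2)"
    by (simp add: power2_eq_square algebra_simps)
  then have "AE \<omega> in M. real_cond_exp M F (\<lambda>\<omega>. (f \<omega> - g \<omega>)\<^sup>2) \<omega> = h \<omega> - (g \<omega>)\<^sup>2"
    by (simp add: has_cond_exp_def)
  moreover have "AE \<omega> in M. real_cond_exp M F (\<lambda>\<omega>'. (f \<omega>' - real_cond_exp M F f \<omega>')\<^sup>2) \<omega>
      = real_cond_exp M F (\<lambda>\<omega>'. (f \<omega>' - g \<omega>')\<^sup>2) \<omega>"
    using assms(1) by (intro real_cond_exp_cong) (auto simp: has_cond_exp_def)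
  ultimately show ?thesis by auto
qed

end

lemma (in finite_measure_subalgebra) has_cond_exp_charact:
  assumes "integrable M f" "integrable M g" "g \<in> borel_measurable F"
    "\<And>A. A \<in> sets F \<Longrightarrow> (\<integral>\<omega>\<in>A. f \<omega> \<partial>M) = (\<integral>\<omega>\<in>A. g \<omega> \<partial>M)"
  shows "has_cond_exp M F f g"
  using assms real_cond_exp_charact unfolding has_cond_exp_def by auto

text \<open>A vector is the finite sum of its coordinates placed on the axes. Entries may lie in any
  Euclidean space, so that a matrix can be treated first by rows and then by entries.\<close>

lemma integrable_vec:
  fixes f :: "'a \<Rightarrow> 'b::euclidean_space^'n"
  assumes "\<And>i. integrable M (\<lambda>\<omega>. f \<omega> $ i)"
  shows "integrable M f"
proof -
  have "linear (\<lambda>x. axis i x :: 'b^'n)" for i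
    by (rule linearI) (auto simp: axis_def vec_eq_iff)
  then have "integrable M (\<lambda>\<omega>. \<Sum>i\<in>UNIV. (axis i (f \<omega> $ i) :: 'b^'n))"
    by (intro Bochner_Integration.integrable_sum integrable_bounded_linear[OF _ assms])
      (simp add: linear_conv_bounded_linear)
  moreover have "(\<Sum>i\<in>UNIV. axis i (f \<omega> $ i)) = f \<omega>" for \<omega>
    by (simp add: vec_eq_iff axis_def)
  ultimately show ?thesis by simp
qed

lemma integral_vec_nth:
  fixes f :: "'a \<Rightarrow> 'b::euclidean_space^'n"
  assumes "integrable M f"
  shows "(\<integral>\<omega>. f \<omega> \<partial>M) $ i = (\<integral>\<omega>. f \<omega> $ i \<partial>M)"
  using integral_bounded_linear[OF bounded_linear_vec_nth assms, of i] by simp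

section \<open>Moments and conditional expectations in the market\<close>

lemma space_filt [simp]: "space (filt M e k) = space M"
  unfolding filt_def by (rule space_measure_of) auto

lemma sets_filt:
  "sets (filt M e k) = sigma_sets (space M) (\<Union>l<k. {e l -` A \<inter> space M | A. A \<in> sets borel})"
  unfolding filt_def by (rule sets_measure_of) auto

lemma subalgebra_filt_mono: "j \<le> k \<Longrightarrow> subalgebra (filt M e k) (filt M e j)"
  unfolding subalgebra_def sets_filt by (force intro!: sigma_sets_mono')

lemma measurable_filt: "l < k \<Longrightarrow> e l \<in> borel_measurable (filt M e k)"
  by (rule measurableI) (force simp: sets_filt intro!: sigma_sets.Basic)+

locale market = prob_space M for M :: "'a measure" +
  fixes N :: nat and s :: "nat \<Rightarrow> real" and e :: "nat \<Rightarrow> 'a \<Rightarrow> real^'m"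
  assumes e_measurable: "\<And>k. k < N \<Longrightarrow> e k \<in> borel_measurable M"
    and e_square_integrable: "\<And>k. k < N \<Longrightarrow> integrable M (\<lambda>\<omega>. (norm (e k \<omega>))\<^sup>2)"
    and indep_e: "indep_vars (\<lambda>_. borel) e {..<N}"
begin

abbreviation "\<F> \<equiv> filt M e"
abbreviation "O' \<equiv> excess s e"
abbreviation "EO \<equiv> mean_excess M s e"
abbreviation "E2 \<equiv> second_moment_excess M s e"
abbreviation "Cov \<equiv> cov_excess M s e"

lemma subalgebra_filt:
  assumes "k \<le> N"
  shows "subalgebra M (\<F> k)"
proof -
  have "(\<Union>l<k. {e l -` A \<inter> space M | A. A \<in> sets borel}) \<subseteq> events"
    using e_measurable assms by (auto intro!: measurable_sets)
  then have "sigma_sets (space M) (\<Union>l<k. {e l -` A \<inter> space M | A. A \<in> sets borel}) \<subseteq> events"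
    by (rule sets.sigma_sets_subset)
  then show ?thesis by (simp add: subalgebra_def sets_filt)
qed

lemma finite_measure_subalgebra_filt: "k \<le> N \<Longrightarrow> finite_measure_subalgebra M (\<F> k)"
  by unfold_locales (rule subalgebra_filt)

lemma measurable_from_filt: "k \<le> N \<Longrightarrow> f \<in> measurable (\<F> k) L \<Longrightarrow> f \<in> measurable M L"
  by (rule measurable_from_subalg[OF subalgebra_filt])

text \<open>The generators of the past and of the present return form two disjoint blocks of an
  independent family of intersection-stable systems. The sigma-algebras generated by the blocks are
  therefore independent, and \<open>W\<close> and \<open>\<phi> (e k)\<close> are measurable with
  respect to one each.\<close>

lemma indep_var_filt:
  fixes W :: "'a \<Rightarrow> real" and \<phi> :: "real^'m \<Rightarrow> real"
  assumes k: "k < N" and W: "W \<in> borel_measurable (\<F> k)" and \<phi>: "\<phi> \<in> borel_measurable borel"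
  shows "indep_var borel W borel (\<lambda>\<omega>. \<phi> (e k \<omega>))"
proof -
  let ?E = "\<lambda>l. {e l -` A \<inter> space M | A. A \<in> sets borel}"
  \<comment> \<open>\<open>True\<close> indexes the past, \<open>False\<close> the present; this is
    the indexing behind \<open>indep_set\<close>.\<close>
  let ?I = "\<lambda>b. if b then {..<k} else {k}"
  have "indep_sets ?E (\<Union>b\<in>UNIV. ?I b)"
    using indep_e k unfolding indep_vars_def2 by (auto intro: indep_sets_mono_index[rotated])
  moreover have "Int_stable (?E l)" for l
    unfolding Int_stable_def
  proof safe
    fix A B :: "(real^'m) set" assume "A \<in> sets borel" "B \<in> sets borel"
    then show "\<exists>C. e l -` A \<inter> space M \<inter> (e l -` B \<inter> space M) = e l -` C \<inter> space M \<and> C \<in> sets borel"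
      by (intro exI[of _ "A \<inter> B"]) auto
  qed
  moreover have "disjoint_family ?I"
    by (auto simp: disjoint_family_on_def)
  ultimately have ind: "indep_sets (\<lambda>b. sigma_sets (space M) (\<Union>l\<in>?I b. ?E l)) UNIV"
    by (intro indep_sets_collect_sigma) auto
  have W': "sigma_sets (space M) {W -` A \<inter> space M | A. A \<in> sets borel}
      \<subseteq> sigma_sets (space M) (\<Union>l<k. ?E l)"
  proof (rule sigma_sets_mono)
    show "{W -` A \<inter> space M | A. A \<in> sets borel} \<subseteq> sigma_sets (space M) (\<Union>l<k. ?E l)"
      using measurable_sets[OF W] by (auto simp: sets_filt)
  qed
  have \<phi>': "sigma_sets (space M) {(\<lambda>\<omega>. \<phi> (e k \<omega>)) -` A \<inter> space M | A. A \<in> sets borel}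
      \<subseteq> sigma_sets (space M) (?E k)"
  proof (rule sigma_sets_mono', safe)
    fix A :: "real set" assume "A \<in> sets borel"
    then show "\<exists>B. (\<lambda>\<omega>. \<phi> (e k \<omega>)) -` A \<inter> space M = e k -` B \<inter> space M \<and> B \<in> sets borel"
      using measurable_sets[OF \<phi>] by (intro exI[of _ "\<phi> -` A"]) auto
  qed
  have "indep_set (sigma_sets (space M) {W -` A \<inter> space M | A. A \<in> sets borel})
      (sigma_sets (space M) {(\<lambda>\<omega>. \<phi> (e k \<omega>)) -` A \<inter> space M | A. A \<in> sets borel})"
    unfolding indep_set_def
    by (rule indep_sets_mono_sets[OF ind]) (use W' \<phi>' in \<open>auto split: bool.split\<close>)
  moreover have "random_variable borel W"
    using measurable_from_filt[of k] k W by simp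
  moreover have "random_variable borel (\<lambda>\<omega>. \<phi> (e k \<omega>))"
    using measurable_compose[OF e_measurable[OF k] \<phi>] .
  ultimately show ?thesis unfolding indep_var_eq by blast
qed

text \<open>The known factor stays and the independent factor is averaged. It suffices to compare
  integrals over each \<open>A\<close> in the filtration.\<close>

lemma has_cond_exp_indep:
  fixes W :: "'a \<Rightarrow> real" and \<phi> :: "real^'m \<Rightarrow> real"
  assumes k: "k < N" and W: "W \<in> borel_measurable (\<F> k)" "integrable M W"
    and \<phi>: "\<phi> \<in> borel_measurable borel" "integrable M (\<lambda>\<omega>. \<phi> (e k \<omega>))"
  shows "has_cond_exp M (\<F> k) (\<lambda>\<omega>. W \<omega> * \<phi> (e k \<omega>)) (\<lambda>\<omega>. W \<omega> * (\<integral>\<omega>. \<phi> (e k \<omega>) \<partial>M))"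
proof -
  interpret F: finite_measure_subalgebra M "\<F> k"
    using k by (simp add: finite_measure_subalgebra_filt)
  show ?thesis
  proof (rule F.has_cond_exp_charact)
    show "integrable M (\<lambda>\<omega>. W \<omega> * \<phi> (e k \<omega>))"
      by (rule indep_var_integrable[OF indep_var_filt]) fact+
    show "integrable M (\<lambda>\<omega>. W \<omega> * (\<integral>\<omega>. \<phi> (e k \<omega>) \<partial>M))"
      using W by simp
    show "(\<lambda>\<omega>. W \<omega> * (\<integral>\<omega>. \<phi> (e k \<omega>) \<partial>M)) \<in> borel_measurable (\<F> k)"
      using W by simp
  next
    fix A assume A: "A \<in> sets (\<F> k)"
    \<comment> \<open>Absorbing the indicator into the known factor keeps it measurable at time
      \<open>k\<close>, so the product rule for independent variables applies to the integral over
      \<open>A\<close>.\<close>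
    let ?V = "\<lambda>\<omega>. indicator A \<omega> * W \<omega>"
    have "?V \<in> borel_measurable (\<F> k)" using A W by simp
    moreover have "integrable M ?V"
      using A W F.subalg integrable_real_mult_indicator[of A M W]
      by (auto simp: subalgebra_def mult.commute)
    ultimately have "(\<integral>\<omega>. ?V \<omega> * \<phi> (e k \<omega>) \<partial>M) = (\<integral>\<omega>. ?V \<omega> \<partial>M) * (\<integral>\<omega>. \<phi> (e k \<omega>) \<partial>M)"
      using k \<phi> by (intro indep_var_lebesgue_integral indep_var_filt)
    then show "(\<integral>\<omega>\<in>A. W \<omega> * \<phi> (e k \<omega>) \<partial>M) = (\<integral>\<omega>\<in>A. W \<omega> * (\<integral>\<omega>. \<phi> (e k \<omega>) \<partial>M) \<partial>M)"
      by (simp add: set_lebesgue_integral_def mult.assoc[symmetric])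
  qed
qed

section \<open>Closure properties of the square-integrable adapted spaces\<close>

lemma integrable_l2F_mult:
  assumes "k \<le> N" "f \<in> l2F M e k" "g \<in> l2F M e k"
  shows "integrable M (\<lambda>\<omega>. f \<omega> * g \<omega> :: real)"
proof (rule Bochner_Integration.integrable_bound)
  show "integrable M (\<lambda>\<omega>. (f \<omega>)\<^sup>2 + (g \<omega>)\<^sup>2)"
    using assms by (simp add: l2F_def)
  show "AE \<omega> in M. norm (f \<omega> * g \<omega>) \<le> norm ((f \<omega>)\<^sup>2 + (g \<omega>)\<^sup>2)"
    by (simp add: abs_mult_le_sum_squares)
  show "(\<lambda>\<omega>. f \<omega> * g \<omega>) \<in> borel_measurable M"
    using assms by (intro borel_measurable_times measurable_from_filt[of k]) (auto simp: l2F_def)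
qed

lemma l2F_const: "(\<lambda>_. c) \<in> l2F M e k"
  by (simp add: l2F_def)

lemma l2F_add:
  fixes f g :: "'a \<Rightarrow> 'b::euclidean_space"
  assumes "k \<le> N" "f \<in> l2F M e k" "g \<in> l2F M e k"
  shows "(\<lambda>\<omega>. f \<omega> + g \<omega>) \<in> l2F M e k"
proof -
  have "integrable M (\<lambda>\<omega>. (norm (f \<omega> + g \<omega>))\<^sup>2)"
  proof (rule Bochner_Integration.integrable_bound)
    show "integrable M (\<lambda>\<omega>. 2 * (norm (f \<omega>))\<^sup>2 + 2 * (norm (g \<omega>))\<^sup>2)"
      using assms by (simp add: l2F_def)
    \<comment> \<open>Parallelogram law: the two sides differ by the square of
      \<open>norm (a - b)\<close>.\<close>
    have "(norm (a + b))\<^sup>2 \<le> 2 * (norm a)\<^sup>2 + 2 * (norm b)\<^sup>2" for a b :: 'b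
    proof -
      have "0 \<le> (norm (a - b))\<^sup>2" by simp
      then show ?thesis
        by (simp add: power2_norm_eq_inner inner_add_left inner_add_right inner_diff_left
            inner_diff_right inner_commute)
    qed
    then show "AE \<omega> in M. norm ((norm (f \<omega> + g \<omega>))\<^sup>2)
        \<le> norm (2 * (norm (f \<omega>))\<^sup>2 + 2 * (norm (g \<omega>))\<^sup>2)" by simp
    have "f \<in> borel_measurable M" "g \<in> borel_measurable M"
      using assms by (auto intro!: measurable_from_filt[of k] simp: l2F_def)
    then show "(\<lambda>\<omega>. (norm (f \<omega> + g \<omega>))\<^sup>2) \<in> borel_measurable M" by simp
  qed
  then show ?thesis using assms by (auto simp: l2F_def)
qed

lemma l2F_scaleR:
  assumes "f \<in> l2F M e k"
  shows "(\<lambda>\<omega>. f \<omega> *\<^sub>R (v :: 'b::euclidean_space)) \<in> l2F M e k"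
  using assms by (auto simp: l2F_def power_mult_distrib)

lemma l2F_nth:
  fixes f :: "'a \<Rightarrow> real^'n"
  assumes "k \<le> N" "f \<in> l2F M e k"
  shows "(\<lambda>\<omega>. f \<omega> $ i) \<in> l2F M e k"
proof -
  have "(\<lambda>x :: real^'n. x $ i) \<in> borel_measurable borel"
    by (intro borel_measurable_continuous_onI continuous_intros)
  moreover have "f \<in> borel_measurable (\<F> k)"
    using assms by (simp add: l2F_def)
  ultimately have f: "(\<lambda>\<omega>. f \<omega> $ i) \<in> borel_measurable (\<F> k)"
    by (rule measurable_compose[rotated])
  then have f': "(\<lambda>\<omega>. f \<omega> $ i) \<in> borel_measurable M"
    using assms(1) by (rule measurable_from_filt[rotated])
  have "integrable M (\<lambda>\<omega>. (f \<omega> $ i)\<^sup>2)"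
  proof (rule Bochner_Integration.integrable_bound)
    show "integrable M (\<lambda>\<omega>. (norm (f \<omega>))\<^sup>2)" using assms by (simp add: l2F_def)
    have "(a $ i)\<^sup>2 \<le> (norm a)\<^sup>2" for a :: "real^'n"
      using component_le_norm_cart[of a i] by (metis abs_ge_zero power2_abs power_mono)
    then show "AE \<omega> in M. norm ((f \<omega> $ i)\<^sup>2) \<le> norm ((norm (f \<omega>))\<^sup>2)" by simp
    show "(\<lambda>\<omega>. (f \<omega> $ i)\<^sup>2) \<in> borel_measurable M" using f' by simp
  qed
  then show ?thesis using f by (simp add: l2F_def)
qed

text \<open>The filtration at \<open>k\<close> is generated by the returns with index below
  \<open>k\<close>, hence the shift to \<open>Suc k\<close>.\<close>

lemma e_in_l2F: "k < N \<Longrightarrow> e k \<in> l2F M e (Suc k)"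
  using e_square_integrable measurable_filt[of k "Suc k" e M] by (simp add: l2F_def)

lemma excess_in_l2F:
  assumes "k < N"
  shows "O' k \<in> l2F M e (Suc k)"
proof -
  have "O' k = (\<lambda>\<omega>. e k \<omega> + (\<chi> i. - s k))"
    by (simp add: excess_def fun_eq_iff vec_eq_iff)
  then show ?thesis using l2F_add[OF _ e_in_l2F l2F_const] assms by simp
qed

lemma integrable_l2F:
  assumes "k \<le> N" "f \<in> l2F M e k"
  shows "integrable M (f :: 'a \<Rightarrow> real)"
  using integrable_l2F_mult[OF assms l2F_const[of 1]] by simp

section \<open>Mean, second moment and covariance of the excess returns\<close>

lemma integrable_excess_nth: "k < N \<Longrightarrow> integrable M (\<lambda>\<omega>. O' k \<omega> $ i)"
  by (intro integrable_l2F[of "Suc k"] l2F_nth[of "Suc k"] excess_in_l2F) auto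

lemma integrable_excess_mult: "k < N \<Longrightarrow> integrable M (\<lambda>\<omega>. O' k \<omega> $ i * O' k \<omega> $ j)"
  by (intro integrable_l2F_mult[of "Suc k"] l2F_nth[of "Suc k"] excess_in_l2F) auto

lemma mean_excess_nth: "k < N \<Longrightarrow> EO k $ i = (\<integral>\<omega>. O' k \<omega> $ i \<partial>M)"
  unfolding mean_excess_def by (intro integral_vec_nth integrable_vec integrable_excess_nth)

lemma second_moment_excess_nth:
  assumes "k < N"
  shows "E2 k $ i $ j = (\<integral>\<omega>. O' k \<omega> $ i * O' k \<omega> $ j \<partial>M)"
proof -
  have "integrable M (\<lambda>\<omega>. outer (O' k \<omega>) (O' k \<omega>))"
    and "integrable M (\<lambda>\<omega>. outer (O' k \<omega>) (O' k \<omega>) $ i)"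
    by (intro integrable_vec, simp add: outer_def integrable_excess_mult[OF assms])+
  then show ?thesis
    unfolding second_moment_excess_def by (simp add: integral_vec_nth outer_def)
qed

lemma integrable_cov_integrand:
  assumes "k < N"
  shows "integrable M (\<lambda>\<omega>. outer (O' k \<omega> - EO k) (O' k \<omega> - EO k))"
  by (intro integrable_vec, simp add: outer_def algebra_simps)
    (intro Bochner_Integration.integrable_add Bochner_Integration.integrable_diff
      integrable_excess_mult[OF assms] integrable_mult_left integrable_mult_right
      integrable_excess_nth[OF assms] integrable_const)

text \<open>Conditioning produces second moments \<open>E2\<close>, while \<open>bbO\<close> is
  written with the covariance; this identity translates between them.\<close>

lemma cov_excess_eq:
  assumes "k < N"
  shows "Cov k = E2 k - outer (EO k) (EO k)"
proof -
  have "Cov k $ i $ j = E2 k $ i $ j - EO k $ i * EO k $ j" for i j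
  proof -
    note [simp] = integrable_excess_mult[OF assms] integrable_excess_nth[OF assms]
    have int: "integrable M (\<lambda>\<omega>. outer (O' k \<omega> - EO k) (O' k \<omega> - EO k) $ i)"
      using integrable_bounded_linear[OF bounded_linear_vec_nth integrable_cov_integrand[OF assms]] .
    have "Cov k $ i $ j = (\<integral>\<omega>. (O' k \<omega> $ i - EO k $ i) * (O' k \<omega> $ j - EO k $ j) \<partial>M)"
      unfolding cov_excess_def
      by (simp add: integral_vec_nth integrable_cov_integrand[OF assms] int) (simp add: outer_def)
    also have "\<dots> = (\<integral>\<omega>. O' k \<omega> $ i * O' k \<omega> $ j + - EO k $ j * O' k \<omega> $ i
        + - EO k $ i * O' k \<omega> $ j + EO k $ i * EO k $ j \<partial>M)"
      by (intro Bochner_Integration.integral_cong) (auto simp: algebra_simps)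
    also have "\<dots> = E2 k $ i $ j - EO k $ i * EO k $ j"
      by (simp add: second_moment_excess_nth[OF assms] mean_excess_nth[OF assms] prob_space)
    finally show ?thesis .
  qed
  then show ?thesis by (simp add: vec_eq_iff outer_def)
qed

text \<open>The quadratic form is linear in the matrix and so passes under the integral, where it
  becomes the square of the centred return tested against \<open>v\<close>.\<close>

lemma psd_cov_excess:
  assumes "k < N"
  shows "psd (Cov k)"
proof -
  have "E2 k $ i $ j = E2 k $ j $ i" for i j
    by (simp add: second_moment_excess_nth[OF assms] mult.commute)
  then have "transpose (Cov k) = Cov k"
    by (simp add: cov_excess_eq[OF assms] transpose_def vec_eq_iff outer_def mult.commute)
  moreover have "0 \<le> v \<bullet> (Cov k *v v)" for v
  proof -
    have "linear (\<lambda>A :: real^'m^'m. v \<bullet> (A *v v))"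
      by (rule linearI) (simp_all add: matrix_vector_mult_add_rdistrib inner_add_right
          scaleR_matrix_vector_assoc[symmetric])
    then have "v \<bullet> (Cov k *v v)
        = (\<integral>\<omega>. v \<bullet> (outer (O' k \<omega> - EO k) (O' k \<omega> - EO k) *v v) \<partial>M)"
      unfolding cov_excess_def
      by (intro integral_bounded_linear[symmetric] integrable_cov_integrand[OF assms])
        (simp add: linear_conv_bounded_linear)
    also have "0 \<le> \<dots>"
      by (intro Bochner_Integration.integral_nonneg)
        (simp add: outer_mult_vec inner_commute[of v])
    finally show ?thesis .
  qed
  ultimately show ?thesis by (simp add: psd_def)
qed

end

section \<open>One-step conditional moments of wealth\<close>

context market
begin

lemma l2F_inner:
  fixes u :: "'a \<Rightarrow> 'b::euclidean_space"
  assumes "k \<le> N" "u \<in> l2F M e k"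
  shows "(\<lambda>\<omega>. v \<bullet> u \<omega>) \<in> l2F M e k"
proof -
  have u: "u \<in> borel_measurable (\<F> k)" using assms by (simp add: l2F_def)
  have "integrable M (\<lambda>\<omega>. (v \<bullet> u \<omega>)\<^sup>2)"
  proof (rule Bochner_Integration.integrable_bound)
    show "integrable M (\<lambda>\<omega>. (norm v)\<^sup>2 * (norm (u \<omega>))\<^sup>2)"
      using assms by (simp add: l2F_def)
    have "(v \<bullet> a)\<^sup>2 \<le> (norm v)\<^sup>2 * (norm a)\<^sup>2" for a
      using Cauchy_Schwarz_ineq[of v a] by (simp add: power2_norm_eq_inner)
    then show "AE \<omega> in M. norm ((v \<bullet> u \<omega>)\<^sup>2) \<le> norm ((norm v)\<^sup>2 * (norm (u \<omega>))\<^sup>2)"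
      by simp
    show "(\<lambda>\<omega>. (v \<bullet> u \<omega>)\<^sup>2) \<in> borel_measurable M"
      using measurable_from_filt[OF assms(1) u] by simp
  qed
  then show ?thesis using u by (simp add: l2F_def)
qed

lemma l2F_mono: "j \<le> k \<Longrightarrow> f \<in> l2F M e j \<Longrightarrow> f \<in> l2F M e k"
  by (auto simp: l2F_def intro: measurable_from_subalg[OF subalgebra_filt_mono])

lemma has_cond_exp_excess:
  assumes k: "k < N" and W: "W \<in> borel_measurable (\<F> k)" "integrable M W"
  shows "has_cond_exp M (\<F> k) (\<lambda>\<omega>. W \<omega> * O' k \<omega> $ i) (\<lambda>\<omega>. W \<omega> * EO k $ i)"
proof -
  have "(\<lambda>x :: real^'m. x $ i - s k) \<in> borel_measurable borel"
    by (intro borel_measurable_continuous_onI continuous_intros)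
  moreover have "(\<lambda>\<omega>. e k \<omega> $ i - s k) = (\<lambda>\<omega>. O' k \<omega> $ i)"
    by (simp add: excess_def)
  ultimately show ?thesis
    using has_cond_exp_indep[OF assms, of "\<lambda>x. x $ i - s k"] integrable_excess_nth[OF k, of i]
    by (simp add: mean_excess_nth[OF k] excess_def)
qed

lemma has_cond_exp_excess_mult:
  assumes k: "k < N" and W: "W \<in> borel_measurable (\<F> k)" "integrable M W"
  shows "has_cond_exp M (\<F> k) (\<lambda>\<omega>. W \<omega> * (O' k \<omega> $ i * O' k \<omega> $ j)) (\<lambda>\<omega>. W \<omega> * E2 k $ i $ j)"
proof -
  have "(\<lambda>x :: real^'m. (x $ i - s k) * (x $ j - s k)) \<in> borel_measurable borel"
    by (intro borel_measurable_continuous_onI continuous_intros)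
  then show ?thesis
    using has_cond_exp_indep[OF assms, of "\<lambda>x. (x $ i - s k) * (x $ j - s k)"]
      integrable_excess_mult[OF k, of i j]
    by (simp add: second_moment_excess_nth[OF k] excess_def)
qed

text \<open>In coordinates, next wealth and its square are finite sums of terms known at time
  \<open>k\<close> times monomials of degree at most two in the excess return. Conditioning replaces
  each monomial by its mean.\<close>

lemma has_cond_exp_step:
  assumes k: "k < N" and \<xi>: "\<xi> \<in> l2F M e k" and u: "u \<in> l2F M e k"
  shows "has_cond_exp M (\<F> k) (\<lambda>\<omega>. s k * \<xi> \<omega> + O' k \<omega> \<bullet> u \<omega>) (\<lambda>\<omega>. s k * \<xi> \<omega> + EO k \<bullet> u \<omega>)"
    and "has_cond_exp M (\<F> k) (\<lambda>\<omega>. (s k * \<xi> \<omega> + O' k \<omega> \<bullet> u \<omega>)\<^sup>2)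
      (\<lambda>\<omega>. (s k)\<^sup>2 * (\<xi> \<omega>)\<^sup>2 + 2 * s k * \<xi> \<omega> * (EO k \<bullet> u \<omega>) + u \<omega> \<bullet> (E2 k *v u \<omega>))"
proof -
  interpret F: finite_measure_subalgebra M "\<F> k"
    using k by (simp add: finite_measure_subalgebra_filt)
  have kN: "k \<le> N" using k by simp
  have ui: "(\<lambda>\<omega>. u \<omega> $ i) \<in> l2F M e k" for i
    by (rule l2F_nth[OF kN u])
  have meas: "\<xi> \<in> borel_measurable (\<F> k)" "\<And>i. (\<lambda>\<omega>. u \<omega> $ i) \<in> borel_measurable (\<F> k)"
    using \<xi> ui by (auto simp: l2F_def)
  have int: "integrable M \<xi>" "\<And>i. integrable M (\<lambda>\<omega>. u \<omega> $ i)"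
    "\<And>i. integrable M (\<lambda>\<omega>. \<xi> \<omega> * u \<omega> $ i)" "\<And>i j. integrable M (\<lambda>\<omega>. u \<omega> $ i * u \<omega> $ j)"
    "integrable M (\<lambda>\<omega>. (\<xi> \<omega>)\<^sup>2)"
    using \<xi> by (auto intro: integrable_l2F integrable_l2F_mult kN ui \<xi> simp: l2F_def)
  have "has_cond_exp M (\<F> k) (\<lambda>\<omega>. s k * \<xi> \<omega> + (\<Sum>i\<in>UNIV. u \<omega> $ i * O' k \<omega> $ i))
      (\<lambda>\<omega>. s k * \<xi> \<omega> + (\<Sum>i\<in>UNIV. u \<omega> $ i * EO k $ i))"
    by (intro F.has_cond_exp_add F.has_cond_exp_cmult F.has_cond_exp_F_meas F.has_cond_exp_sum
        has_cond_exp_excess k meas int finite)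
  then show "has_cond_exp M (\<F> k) (\<lambda>\<omega>. s k * \<xi> \<omega> + O' k \<omega> \<bullet> u \<omega>) (\<lambda>\<omega>. s k * \<xi> \<omega> + EO k \<bullet> u \<omega>)"
    by (simp add: inner_vec_def mult.commute)
  have "has_cond_exp M (\<F> k)
      (\<lambda>\<omega>. (s k)\<^sup>2 * (\<xi> \<omega>)\<^sup>2 + (2 * s k) * (\<Sum>i\<in>UNIV. (\<xi> \<omega> * u \<omega> $ i) * O' k \<omega> $ i)
        + (\<Sum>i\<in>UNIV. \<Sum>j\<in>UNIV. (u \<omega> $ i * u \<omega> $ j) * (O' k \<omega> $ i * O' k \<omega> $ j)))
      (\<lambda>\<omega>. (s k)\<^sup>2 * (\<xi> \<omega>)\<^sup>2 + (2 * s k) * (\<Sum>i\<in>UNIV. (\<xi> \<omega> * u \<omega> $ i) * EO k $ i)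
        + (\<Sum>i\<in>UNIV. \<Sum>j\<in>UNIV. (u \<omega> $ i * u \<omega> $ j) * E2 k $ i $ j))"
    by (intro F.has_cond_exp_add F.has_cond_exp_cmult F.has_cond_exp_F_meas F.has_cond_exp_sum
        has_cond_exp_excess has_cond_exp_excess_mult k meas int finite
        borel_measurable_times borel_measurable_power)
  moreover have "(s k)\<^sup>2 * (\<xi> \<omega>)\<^sup>2 + (2 * s k) * (\<Sum>i\<in>UNIV. (\<xi> \<omega> * u \<omega> $ i) * O' k \<omega> $ i)
        + (\<Sum>i\<in>UNIV. \<Sum>j\<in>UNIV. (u \<omega> $ i * u \<omega> $ j) * (O' k \<omega> $ i * O' k \<omega> $ j))
      = (s k * \<xi> \<omega> + O' k \<omega> \<bullet> u \<omega>)\<^sup>2" for \<omega>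
  proof -
    have "(O' k \<omega> \<bullet> u \<omega>) * (O' k \<omega> \<bullet> u \<omega>)
        = (\<Sum>i\<in>UNIV. \<Sum>j\<in>UNIV. (u \<omega> $ i * u \<omega> $ j) * (O' k \<omega> $ i * O' k \<omega> $ j))"
      unfolding inner_vec_def sum_product by (simp add: mult_ac)
    moreover have "\<xi> \<omega> * (O' k \<omega> \<bullet> u \<omega>) = (\<Sum>i\<in>UNIV. (\<xi> \<omega> * u \<omega> $ i) * O' k \<omega> $ i)"
      unfolding inner_vec_def sum_distrib_left by (simp add: mult_ac)
    ultimately show ?thesis by (simp add: power2_eq_square algebra_simps)
  qed
  moreover have "(2 * s k) * (\<Sum>i\<in>UNIV. (\<xi> \<omega> * u \<omega> $ i) * EO k $ i)
      = 2 * s k * \<xi> \<omega> * (EO k \<bullet> u \<omega>)" for \<omega>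
    unfolding inner_vec_def sum_distrib_left by (simp add: mult_ac)
  moreover have "(\<Sum>i\<in>UNIV. \<Sum>j\<in>UNIV. (u \<omega> $ i * u \<omega> $ j) * E2 k $ i $ j)
      = u \<omega> \<bullet> (E2 k *v u \<omega>)" for \<omega>
    unfolding inner_vec_def matrix_vector_mult_def by (simp add: sum_distrib_left mult_ac)
  ultimately show "has_cond_exp M (\<F> k) (\<lambda>\<omega>. (s k * \<xi> \<omega> + O' k \<omega> \<bullet> u \<omega>)\<^sup>2)
      (\<lambda>\<omega>. (s k)\<^sup>2 * (\<xi> \<omega>)\<^sup>2 + 2 * s k * \<xi> \<omega> * (EO k \<bullet> u \<omega>) + u \<omega> \<bullet> (E2 k *v u \<omega>))"
    by simp
qed

text \<open>A product of square-integrable functions need not be square integrable; here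
  independence of the return from the control rescues it. The fact is read off the integrability
  contained in the second conditional moment.\<close>

lemma step_in_l2F:
  assumes k: "k < N" and \<xi>: "\<xi> \<in> l2F M e k" and u: "u \<in> l2F M e k"
  shows "(\<lambda>\<omega>. s k * \<xi> \<omega> + O' k \<omega> \<bullet> u \<omega>) \<in> l2F M e (Suc k)"
proof -
  have "\<xi> \<in> borel_measurable (\<F> (Suc k))" "u \<in> borel_measurable (\<F> (Suc k))"
    using l2F_mono[OF _ \<xi>, of "Suc k"] l2F_mono[OF _ u, of "Suc k"] by (auto simp: l2F_def)
  moreover have "O' k \<in> borel_measurable (\<F> (Suc k))"
    using excess_in_l2F[OF k] by (simp add: l2F_def)
  ultimately have "(\<lambda>\<omega>. s k * \<xi> \<omega> + O' k \<omega> \<bullet> u \<omega>) \<in> borel_measurable (\<F> (Suc k))"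
    by (intro borel_measurable_add borel_measurable_times borel_measurable_inner borel_measurable_const)
  then show ?thesis
    using has_cond_exp_step(2)[OF assms] by (simp add: l2F_def has_cond_exp_def)
qed

text \<open>Conditional moments of terminal wealth are polynomials of degree at most two in current
  wealth; this rule moves such a polynomial back by one stage. Affine ones are the case
  \<open>\<alpha> = 0\<close>.\<close>

lemma has_cond_exp_quadratic_step:
  assumes k: "k < N" and \<xi>: "\<xi> \<in> l2F M e k" and u: "u \<in> l2F M e k"
  shows "has_cond_exp M (\<F> k)
     (\<lambda>\<omega>. \<alpha> * (s k * \<xi> \<omega> + O' k \<omega> \<bullet> u \<omega>)\<^sup>2 + \<kappa> * (s k * \<xi> \<omega> + O' k \<omega> \<bullet> u \<omega>) + \<delta>)
     (\<lambda>\<omega>. \<alpha> * ((s k)\<^sup>2 * (\<xi> \<omega>)\<^sup>2 + 2 * s k * \<xi> \<omega> * (EO k \<bullet> u \<omega>) + u \<omega> \<bullet> (E2 k *v u \<omega>))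
       + \<kappa> * (s k * \<xi> \<omega> + EO k \<bullet> u \<omega>) + \<delta>)"
proof -
  interpret F: finite_measure_subalgebra M "\<F> k"
    using k by (simp add: finite_measure_subalgebra_filt)
  show ?thesis
    by (intro F.has_cond_exp_add F.has_cond_exp_cmult has_cond_exp_step[OF assms] F.has_cond_exp_F_meas)
      simp_all
qed

lemma second_moment_excess_commute:
  "k < N \<Longrightarrow> v \<bullet> (E2 k *v w) = w \<bullet> (E2 k *v v)"
proof -
  assume k: "k < N"
  have "E2 k $ i $ j = E2 k $ j $ i" for i j
    by (simp add: second_moment_excess_nth[OF k] mult.commute)
  then have "transpose (E2 k) = E2 k"
    by (simp add: transpose_def vec_eq_iff)
  then show ?thesis by (rule symmetric_inner_commute)
qed

end

section \<open>Affine feedback\<close>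

text \<open>Started from \<open>y\<close> at time \<open>k\<close>, the closed loop has terminal wealth \<open>A y + B\<close> with \<open>A\<close>, \<open>B\<close>
  independent of the past; \<open>a\<close>, \<open>b\<close>, \<open>S\<close>, \<open>g\<close>, \<open>h\<close> at \<open>k\<close> are the means of \<open>A\<close>, \<open>B\<close>, \<open>A\<^sup>2\<close>, \<open>A B\<close>, \<open>B\<^sup>2\<close>.\<close>

locale affine_feedback = market M N s e
  for M :: "'a measure" and N :: nat and s :: "nat \<Rightarrow> real" and e :: "nat \<Rightarrow> 'a \<Rightarrow> real^'m" +
  fixes \<Psi> \<gamma> :: "nat \<Rightarrow> real^'m" and a b S g h :: "nat \<Rightarrow> real"
  assumes a: "\<And>j. j < N \<Longrightarrow> a j = a (Suc j) * (s j + EO j \<bullet> \<Psi> j)" "a N = 1"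
    and b: "\<And>j. j < N \<Longrightarrow> b j = a (Suc j) * (EO j \<bullet> \<gamma> j) + b (Suc j)" "b N = 0"
    and S: "\<And>j. j < N \<Longrightarrow>
      S j = S (Suc j) * ((s j)\<^sup>2 + 2 * s j * (EO j \<bullet> \<Psi> j) + \<Psi> j \<bullet> (E2 j *v \<Psi> j))" "S N = 1"
    and g: "\<And>j. j < N \<Longrightarrow> g j = S (Suc j) * (s j * (EO j \<bullet> \<gamma> j) + \<Psi> j \<bullet> (E2 j *v \<gamma> j))
      + g (Suc j) * (s j + EO j \<bullet> \<Psi> j)" "g N = 0"
    and h: "\<And>j. j < N \<Longrightarrow> h j = S (Suc j) * (\<gamma> j \<bullet> (E2 j *v \<gamma> j))
      + 2 * g (Suc j) * (EO j \<bullet> \<gamma> j) + h (Suc j)" "h N = 0"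
begin

text \<open>Backward induction with the tower property: the polynomial in \<open>Y (Suc i)\<close>
  is conditioned once more, and its new coefficients are the recursions of the locale.
  \<open>Y\<close> is any process that follows the feedback from \<open>k\<close> on, so wealth
  after a deviation is covered too.\<close>

lemma closed_loop_moments:
  assumes Yk: "Y k \<in> l2F M e k"
    and Y: "\<And>j. k \<le> j \<Longrightarrow> j < N \<Longrightarrow>
      Y (Suc j) = (\<lambda>\<omega>. s j * Y j \<omega> + O' j \<omega> \<bullet> (Y j \<omega> *\<^sub>R \<Psi> j + \<gamma> j))"
    and j: "k \<le> j" "j \<le> N"
  shows "Y j \<in> l2F M e j"
    and "has_cond_exp M (\<F> j) (Y N) (\<lambda>\<omega>. a j * Y j \<omega> + b j)"
    and "has_cond_exp M (\<F> j) (\<lambda>\<omega>. (Y N \<omega>)\<^sup>2) (\<lambda>\<omega>. S j * (Y j \<omega>)\<^sup>2 + 2 * g j * Y j \<omega> + h j)"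
proof -
  have u: "(\<lambda>\<omega>. Y i \<omega> *\<^sub>R \<Psi> i + \<gamma> i) \<in> l2F M e i" if "Y i \<in> l2F M e i" "i < N" for i
    using that by (intro l2F_add l2F_scaleR l2F_const) auto
  \<comment> \<open>Membership in the adapted spaces runs forward in time and has to be available
    before the backward induction.\<close>
  have l2: "Y i \<in> l2F M e i" if "k \<le> i" "i \<le> N" for i
    using that
  proof (induction i rule: dec_induct)
    case (step i)
    then show ?case using Y[of i] step_in_l2F[of i "Y i"] u[of i] by simp
  qed (rule Yk)
  then show "Y j \<in> l2F M e j" using j by simp
  have "has_cond_exp M (\<F> j) (Y N) (\<lambda>\<omega>. a j * Y j \<omega> + b j) \<and>
    has_cond_exp M (\<F> j) (\<lambda>\<omega>. (Y N \<omega>)\<^sup>2) (\<lambda>\<omega>. S j * (Y j \<omega>)\<^sup>2 + 2 * g j * Y j \<omega> + h j)"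
    using j(2,1)
  proof (induction j rule: inc_induct)
    case base
    interpret F: finite_measure_subalgebra M "\<F> N"
      by (simp add: finite_measure_subalgebra_filt)
    have "Y N \<in> l2F M e N" using l2 base by simp
    moreover from this have "integrable M (Y N)" by (rule integrable_l2F[OF order_refl])
    ultimately show ?case
      by (auto simp: a b S g h l2F_def intro!: F.has_cond_exp_F_meas)
  next
    case (step i)
    interpret F: finite_measure_subalgebra M "\<F> i"
      using step by (simp add: finite_measure_subalgebra_filt)
    have i: "i < N" "k \<le> i" using step by auto
    have Yi: "Y i \<in> l2F M e i" using l2 i by simp
    note Yi' = Y[OF i(2,1)]
    have IH: "has_cond_exp M (\<F> (Suc i)) (Y N) (\<lambda>\<omega>. a (Suc i) * Y (Suc i) \<omega> + b (Suc i))"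
      "has_cond_exp M (\<F> (Suc i)) (\<lambda>\<omega>. (Y N \<omega>)\<^sup>2)
        (\<lambda>\<omega>. S (Suc i) * (Y (Suc i) \<omega>)\<^sup>2 + 2 * g (Suc i) * Y (Suc i) \<omega> + h (Suc i))"
      using step by auto
    note tower = F.has_cond_exp_tower[OF subalgebra_filt subalgebra_filt_mono]
    note quad = has_cond_exp_quadratic_step[OF i(1) Yi u[OF Yi i(1)], folded Yi'[THEN fun_cong]]
    have "a (Suc i) * (s i * Y i \<omega> + EO i \<bullet> (Y i \<omega> *\<^sub>R \<Psi> i + \<gamma> i)) + b (Suc i) = a i * Y i \<omega> + b i" for \<omega>
      using a(1)[OF i(1)] b(1)[OF i(1)] by (simp add: inner_add_right algebra_simps)
    then have 1: "has_cond_exp M (\<F> i) (\<lambda>\<omega>. a (Suc i) * Y (Suc i) \<omega> + b (Suc i)) (\<lambda>\<omega>. a i * Y i \<omega> + b i)"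
      using quad[of 0 "a (Suc i)" "b (Suc i)"] by simp
    \<comment> \<open>Comparing coefficients in \<open>Y i \<omega>\<close>: symmetry of
      \<open>E2\<close> merges the two mixed terms in \<open>\<Psi> i\<close> and
      \<open>\<gamma> i\<close> into the factor 2 in front of \<open>g i\<close>.\<close>
    have "S (Suc i) * ((s i)\<^sup>2 * (Y i \<omega>)\<^sup>2 + 2 * s i * Y i \<omega> * (EO i \<bullet> (Y i \<omega> *\<^sub>R \<Psi> i + \<gamma> i))
          + (Y i \<omega> *\<^sub>R \<Psi> i + \<gamma> i) \<bullet> (E2 i *v (Y i \<omega> *\<^sub>R \<Psi> i + \<gamma> i)))
        + 2 * g (Suc i) * (s i * Y i \<omega> + EO i \<bullet> (Y i \<omega> *\<^sub>R \<Psi> i + \<gamma> i)) + h (Suc i)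
        = S i * (Y i \<omega>)\<^sup>2 + 2 * g i * Y i \<omega> + h i" for \<omega>
      unfolding S(1)[OF i(1)] g(1)[OF i(1)] h(1)[OF i(1)]
      by (simp add: inner_add_right inner_add_left matrix_vector_right_distrib matrix_vector_mult_scaleR
          second_moment_excess_commute[OF i(1), of "\<gamma> i" "\<Psi> i"] power2_eq_square algebra_simps)
    then have 2: "has_cond_exp M (\<F> i)
        (\<lambda>\<omega>. S (Suc i) * (Y (Suc i) \<omega>)\<^sup>2 + 2 * g (Suc i) * Y (Suc i) \<omega> + h (Suc i))
        (\<lambda>\<omega>. S i * (Y i \<omega>)\<^sup>2 + 2 * g i * Y i \<omega> + h i)"
      using quad[of "S (Suc i)" "2 * g (Suc i)" "h (Suc i)"] by simp
    show ?case using tower[OF _ _ IH(1) 1] tower[OF _ _ IH(2) 2] i by simp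
  qed
  then show "has_cond_exp M (\<F> j) (Y N) (\<lambda>\<omega>. a j * Y j \<omega> + b j)"
    and "has_cond_exp M (\<F> j) (\<lambda>\<omega>. (Y N \<omega>)\<^sup>2) (\<lambda>\<omega>. S j * (Y j \<omega>)\<^sup>2 + 2 * g j * Y j \<omega> + h j)"
    by auto
qed

end

section \<open>Cost of a one-stage deviation\<close>

lemma closed_wealth_start: "j \<le> k \<Longrightarrow> closed_wealth s e k \<xi> \<psi> j = \<xi>"
  by (induction j) auto

lemma wealth_closed_control:
  "wealth s e k \<xi> (closed_control s e k \<xi> \<psi>) j = closed_wealth s e k \<xi> \<psi> j"
  by (induction j) (auto simp: closed_control_def)

context affine_feedback
begin

text \<open>From \<open>Suc k\<close> on the feedback is followed, so the closed-loop moments apply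
  there; one more conditioning through the step with control \<open>u\<close> brings them to time
  \<open>k\<close>. Since \<open>\<psi> k\<close> is prescribed only at \<open>\<xi>\<close>, the
  formula serves both the candidate strategy and its deviations.\<close>

lemma cost_deviation:
  assumes k: "k < N" and \<xi>: "\<xi> \<in> l2F M e k" and u: "u \<in> l2F M e k"
    and \<psi>: "\<psi> k \<xi> = u" "\<And>j. k < j \<Longrightarrow> j < N \<Longrightarrow> \<psi> j = (\<lambda>\<zeta> \<omega>. \<zeta> \<omega> *\<^sub>R \<Psi> j + \<gamma> j)"
  shows "AE \<omega> in M. cost M N s e \<mu>1 \<mu>2 k \<xi> (closed_control s e k \<xi> \<psi>) \<omega> =
    S (Suc k) * ((s k)\<^sup>2 * (\<xi> \<omega>)\<^sup>2 + 2 * s k * \<xi> \<omega> * (EO k \<bullet> u \<omega>) + u \<omega> \<bullet> (E2 k *v u \<omega>))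
    + 2 * g (Suc k) * (s k * \<xi> \<omega> + EO k \<bullet> u \<omega>) + h (Suc k)
    - (a (Suc k) * (s k * \<xi> \<omega> + EO k \<bullet> u \<omega>) + b (Suc k))\<^sup>2
    - (\<mu>1 * \<xi> \<omega> + \<mu>2) * (a (Suc k) * (s k * \<xi> \<omega> + EO k \<bullet> u \<omega>) + b (Suc k))"
proof -
  interpret F: finite_measure_subalgebra M "\<F> k"
    using k by (simp add: finite_measure_subalgebra_filt)
  define Y where "Y = closed_wealth s e k \<xi> \<psi>"
  define y where "y = (\<lambda>\<omega>. s k * \<xi> \<omega> + EO k \<bullet> u \<omega>)"
  have YS: "Y (Suc k) = (\<lambda>\<omega>. s k * \<xi> \<omega> + O' k \<omega> \<bullet> u \<omega>)"
    by (simp add: Y_def closed_wealth_start \<psi>)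
  have "Y (Suc k) \<in> l2F M e (Suc k)"
    unfolding YS by (rule step_in_l2F[OF k \<xi> u])
  moreover have "Y (Suc j) = (\<lambda>\<omega>. s j * Y j \<omega> + O' j \<omega> \<bullet> (Y j \<omega> *\<^sub>R \<Psi> j + \<gamma> j))"
    if "Suc k \<le> j" "j < N" for j
    using that \<psi>(2)[of j] by (simp add: Y_def)
  ultimately have m: "has_cond_exp M (\<F> (Suc k)) (Y N) (\<lambda>\<omega>. a (Suc k) * Y (Suc k) \<omega> + b (Suc k))"
    "has_cond_exp M (\<F> (Suc k)) (\<lambda>\<omega>. (Y N \<omega>)\<^sup>2)
      (\<lambda>\<omega>. S (Suc k) * (Y (Suc k) \<omega>)\<^sup>2 + 2 * g (Suc k) * Y (Suc k) \<omega> + h (Suc k))"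
    using closed_loop_moments(2,3)[of Y "Suc k" "Suc k"] k by simp_all
  note tower = F.has_cond_exp_tower[OF subalgebra_filt subalgebra_filt_mono]
  note quad = has_cond_exp_quadratic_step[OF k \<xi> u, folded YS[THEN fun_cong]]
  have 1: "has_cond_exp M (\<F> k) (Y N) (\<lambda>\<omega>. a (Suc k) * y \<omega> + b (Suc k))"
    using tower[OF _ _ m(1)] quad[of 0 "a (Suc k)" "b (Suc k)"] k by (simp add: y_def)
  have 2: "has_cond_exp M (\<F> k) (\<lambda>\<omega>. (Y N \<omega>)\<^sup>2) (\<lambda>\<omega>. S (Suc k) * ((s k)\<^sup>2 * (\<xi> \<omega>)\<^sup>2
      + 2 * s k * \<xi> \<omega> * (EO k \<bullet> u \<omega>) + u \<omega> \<bullet> (E2 k *v u \<omega>)) + 2 * g (Suc k) * y \<omega> + h (Suc k))"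
    using tower[OF _ _ m(2)] quad[of "S (Suc k)" "2 * g (Suc k)" "h (Suc k)"] k by (simp add: y_def)
  have "(\<lambda>\<omega>. a (Suc k) * y \<omega> + b (Suc k)) \<in> l2F M e k"
  proof -
    have "(\<lambda>\<omega>. (a (Suc k) * s k) * \<xi> \<omega> + a (Suc k) * (EO k \<bullet> u \<omega>) + b (Suc k)) \<in> l2F M e k"
      \<comment> \<open>On the reals \<open>inner\<close> is multiplication, so
        \<open>l2F_inner\<close> also gives closure under scaling.\<close>
      using l2F_inner[OF _ l2F_inner[OF _ u, of "EO k"], of "a (Suc k)"]
        l2F_inner[OF _ \<xi>, of "a (Suc k) * s k"] k
      by (intro l2F_add l2F_const) auto
    then show ?thesis by (simp add: y_def algebra_simps)
  qed
  then have "integrable M (\<lambda>\<omega>. (a (Suc k) * y \<omega> + b (Suc k))\<^sup>2)"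
    by (simp add: l2F_def)
  from F.cond_variance[OF 1 2 this] 1[unfolded has_cond_exp_def]
  show ?thesis
    by (auto simp: cost_def Let_def wealth_closed_control Y_def[symmetric] y_def)
qed

text \<open>Both costs are the same quadratic in the stage-\<open>k\<close> control plus a term
  \<open>?K\<close> free of it. The conditions on \<open>\<Psi> k\<close> and
  \<open>\<gamma> k\<close> are the two parts, proportional to wealth and constant, of the
  first-order condition \<open>A *v ?v = - ?w\<close>, so the candidate is a pointwise
  minimizer.\<close>

lemma equilibrium_inequality:
  assumes k: "k < N" and \<xi>: "\<xi> \<in> l2F M e k" and u: "u \<in> l2F M e k"
    and psd: "psd A" and A: "A = Sc *\<^sub>R outer (EO k) (EO k) + S (Suc k) *\<^sub>R Cov k"
    and Sc: "S (Suc k) = Sc + (a (Suc k))\<^sup>2"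
    and \<Psi>: "A *v \<Psi> k = - ((s k * Sc - \<mu>1 / 2 * a (Suc k)) *\<^sub>R EO k)"
    and \<gamma>: "A *v \<gamma> k = - ((g (Suc k) - a (Suc k) * b (Suc k) - \<mu>2 / 2 * a (Suc k)) *\<^sub>R EO k)"
    and \<psi>: "\<And>j. k \<le> j \<Longrightarrow> j < N \<Longrightarrow> \<psi> j = (\<lambda>\<zeta> \<omega>. \<zeta> \<omega> *\<^sub>R \<Psi> j + \<gamma> j)"
  shows "AE \<omega> in M. cost M N s e \<mu>1 \<mu>2 k \<xi> (closed_control s e k \<xi> \<psi>) \<omega>
     \<le> cost M N s e \<mu>1 \<mu>2 k \<xi> (closed_control s e k \<xi> (\<psi>(k := \<lambda>_. u))) \<omega>"
proof -
  let ?v = "\<lambda>\<omega>. \<xi> \<omega> *\<^sub>R \<Psi> k + \<gamma> k"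
  let ?w = "\<lambda>\<omega>. ((s k * Sc - \<mu>1 / 2 * a (Suc k)) * \<xi> \<omega>
      + (g (Suc k) - a (Suc k) * b (Suc k) - \<mu>2 / 2 * a (Suc k))) *\<^sub>R EO k"
  let ?K = "\<lambda>\<omega>. S (Suc k) * (s k * \<xi> \<omega>)\<^sup>2 + 2 * g (Suc k) * (s k * \<xi> \<omega>) + h (Suc k)
     - (a (Suc k) * (s k * \<xi> \<omega>) + b (Suc k))\<^sup>2
     - (\<mu>1 * \<xi> \<omega> + \<mu>2) * (a (Suc k) * (s k * \<xi> \<omega>) + b (Suc k))"
  have v: "?v \<in> l2F M e k"
    using \<xi> k by (intro l2F_add l2F_scaleR l2F_const) auto
  have min: "?v \<omega> \<bullet> (A *v ?v \<omega>) + 2 * (?v \<omega> \<bullet> ?w \<omega>) \<le> u \<omega> \<bullet> (A *v u \<omega>) + 2 * (u \<omega> \<bullet> ?w \<omega>)" for \<omega>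
    by (rule psd_quadratic_min[OF psd])
      (simp add: matrix_vector_right_distrib matrix_vector_mult_scaleR \<Psi> \<gamma> scaleR_left_distrib mult.commute)
  \<comment> \<open>The quadratic part is \<open>S\<close> times \<open>E2\<close> minus
    \<open>a\<^sup>2\<close> times the outer square of the mean. Splitting \<open>E2\<close> into
    covariance and mean leaves the coefficient \<open>S - a\<^sup>2 = Sc\<close> on the mean part,
    which is \<open>A\<close>.\<close>
  have eq: "S (Suc k) * ((s k)\<^sup>2 * x\<^sup>2 + 2 * s k * x * (EO k \<bullet> z) + z \<bullet> (E2 k *v z))
    + 2 * g (Suc k) * (s k * x + EO k \<bullet> z) + h (Suc k)
    - (a (Suc k) * (s k * x + EO k \<bullet> z) + b (Suc k))\<^sup>2
    - (\<mu>1 * x + \<mu>2) * (a (Suc k) * (s k * x + EO k \<bullet> z) + b (Suc k))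
    = z \<bullet> (A *v z) + 2 * (z \<bullet> (((s k * Sc - \<mu>1 / 2 * a (Suc k)) * x
      + (g (Suc k) - a (Suc k) * b (Suc k) - \<mu>2 / 2 * a (Suc k))) *\<^sub>R EO k))
     + (S (Suc k) * (s k * x)\<^sup>2 + 2 * g (Suc k) * (s k * x) + h (Suc k)
     - (a (Suc k) * (s k * x) + b (Suc k))\<^sup>2
     - (\<mu>1 * x + \<mu>2) * (a (Suc k) * (s k * x) + b (Suc k)))" for x z
    unfolding A cov_excess_eq[OF k]
    by (simp add: matrix_vector_mult_add_rdistrib scaleR_matrix_vector_assoc[symmetric] outer_mult_vec
        matrix_vector_mult_diff_rdistrib inner_add_right inner_diff_right Sc inner_commute[of z "EO k"]
        power2_eq_square field_simps)
  have "AE \<omega> in M. cost M N s e \<mu>1 \<mu>2 k \<xi> (closed_control s e k \<xi> \<psi>) \<omega>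
      = ?v \<omega> \<bullet> (A *v ?v \<omega>) + 2 * (?v \<omega> \<bullet> ?w \<omega>) + ?K \<omega>"
    using cost_deviation[OF k \<xi> v, of \<psi> \<mu>1 \<mu>2] \<psi> k unfolding eq by simp
  moreover have "AE \<omega> in M. cost M N s e \<mu>1 \<mu>2 k \<xi> (closed_control s e k \<xi> (\<psi>(k := \<lambda>_. u))) \<omega>
      = u \<omega> \<bullet> (A *v u \<omega>) + 2 * (u \<omega> \<bullet> ?w \<omega>) + ?K \<omega>"
    using cost_deviation[OF k \<xi> u, of "\<psi>(k := \<lambda>_. u)" \<mu>1 \<mu>2] \<psi> k unfolding eq by simp
  ultimately show ?thesis
  proof eventually_elim
    case (elim \<omega>)
    then show ?case using min[of \<omega>] by linarith
  qed
qed

end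

section \<open>The difference equations: solvability, and the equilibrium obtained from a
  solution\<close>

context market
begin

lemma bbO_inner:
  assumes "k < N"
  shows "v \<bullet> (bbO M s e S Sc k *v w) =
    Sc (Suc k) * (EO k \<bullet> v) * (EO k \<bullet> w) + S (Suc k) * (v \<bullet> (E2 k *v w) - (EO k \<bullet> v) * (EO k \<bullet> w))"
  unfolding bbO_def cov_excess_eq[OF assms]
  by (simp add: matrix_vector_mult_add_rdistrib scaleR_matrix_vector_assoc[symmetric] outer_mult_vec
      matrix_vector_mult_diff_rdistrib inner_add_right inner_diff_right inner_commute[of v "EO k"])

text \<open>Both \<open>bbL\<close> and \<open>\<theta>\<close> are multiples of the mean excess
  return, so a free factor \<open>c\<close> settles the two range constraints at once.\<close>

lemma
  assumes "k < N" "0 < S (Suc k)" "0 \<le> Sc (Suc k)" "EO k \<in> range (\<lambda>v. Cov k *v v)"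
  shows psd_bbO: "psd (bbO M s e S Sc k)"
    and bbO_pinv_mean_excess:
      "bbO M s e S Sc k *v (pinv (bbO M s e S Sc k) *v (c *\<^sub>R EO k)) = c *\<^sub>R EO k"
proof -
  show "psd (bbO M s e S Sc k)"
    using assms by (auto simp: bbO_def intro!: psd_rank_one_update psd_cov_excess)
  obtain w where "EO k = Cov k *v w" using assms(4) by blast
  from rank_one_update_range[OF psd_cov_excess[OF assms(1)] assms(3,2) this]
  have "EO k = bbO M s e S Sc k *v (pinv (bbO M s e S Sc k) *v EO k)"
    using mult_pinv_range[of "EO k" "bbO M s e S Sc k"] by (auto simp: bbO_def)
  then show "bbO M s e S Sc k *v (pinv (bbO M s e S Sc k) *v (c *\<^sub>R EO k)) = c *\<^sub>R EO k"
    by (simp add: matrix_vector_mult_scaleR)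
qed

text \<open>These identities rewrite the pseudo-inverse terms of the difference equations through
  the gains \<open>\<Psi>\<close> and \<open>\<gamma>\<close>. They rest on symmetry of the
  pseudo-inverse and on the range constraint for \<open>bbL\<close>.\<close>

lemma
  fixes S Sc U p
  assumes "psd (bbO M s e S Sc k)"
    and "bbO M s e S Sc k *v (pinv (bbO M s e S Sc k) *v bbL M s e Sc U k) = bbL M s e Sc U k"
  defines "\<Psi> \<equiv> - (pinv (bbO M s e S Sc k) *v bbL M s e Sc U k)"
    and "\<gamma> \<equiv> - (pinv (bbO M s e S Sc k) *v \<theta> M s e p k)"
  shows inner_bbL_pinv: "bbL M s e Sc U k \<bullet> (pinv (bbO M s e S Sc k) *v bbL M s e Sc U k)
      = \<Psi> \<bullet> (bbO M s e S Sc k *v \<Psi>)"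
    and inner_bbL_sandwich:
      "bbL M s e Sc U k \<bullet> ((pinv (bbO M s e S Sc k) ** B ** pinv (bbO M s e S Sc k)) *v bbL M s e Sc U k)
      = \<Psi> \<bullet> (B *v \<Psi>)"
    and inner_\<beta>: "\<beta> M s e S Sc U k \<bullet> (pinv (bbO M s e S Sc k) *v \<theta> M s e p k)
      = - (s k * Sc (Suc k) * (EO k \<bullet> \<gamma>) + \<Psi> \<bullet> (bbO M s e S Sc k *v \<gamma>))"
proof -
  let ?A = "bbO M s e S Sc k" and ?L = "bbL M s e Sc U k"
  have "transpose (pinv ?A) = pinv ?A"
    using assms(1) by (auto simp: psd_def intro: transpose_pinv)
  then have sym: "?L \<bullet> (pinv ?A *v z) = z \<bullet> (pinv ?A *v ?L)" for z
    by (rule symmetric_inner_commute)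
  show "?L \<bullet> (pinv ?A *v ?L) = \<Psi> \<bullet> (?A *v \<Psi>)"
    by (simp add: \<Psi>_def matrix_vector_mult_minus assms(2) inner_commute)
  show "?L \<bullet> ((pinv ?A ** B ** pinv ?A) *v ?L) = \<Psi> \<bullet> (B *v \<Psi>)"
    by (simp add: matrix_vector_mul_assoc[symmetric] sym \<Psi>_def matrix_vector_mult_minus inner_commute)
  \<comment> \<open>The bracket in \<open>\<beta>\<close> is \<open>bbO\<close> itself; moving the
    symmetric pseudo-inverse onto \<open>bbL\<close> turns that term into
    \<open>\<Psi>\<close>.\<close>
  have "\<beta> M s e S Sc U k \<bullet> z = s k * Sc (Suc k) * (EO k \<bullet> z) + \<Psi> \<bullet> (?A *v z)" for z
  proof -
    have "\<beta> M s e S Sc U k = (s k * Sc (Suc k)) *\<^sub>R EO k - ?L v* (pinv ?A ** ?A)"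
      by (simp add: \<beta>_def bbO_def)
    then have "\<beta> M s e S Sc U k \<bullet> z = s k * Sc (Suc k) * (EO k \<bullet> z) - ?L \<bullet> (pinv ?A *v (?A *v z))"
      by (simp only: inner_diff_left dot_lmul_matrix matrix_vector_mul_assoc inner_scaleR_left)
    then show ?thesis by (simp add: sym \<Psi>_def inner_commute)
  qed
  from this[of \<gamma>] show "\<beta> M s e S Sc U k \<bullet> (pinv ?A *v \<theta> M s e p k)
      = - (s k * Sc (Suc k) * (EO k \<bullet> \<gamma>) + \<Psi> \<bullet> (?A *v \<gamma>))"
    by (simp add: \<gamma>_def)
qed

lemma difference_equations_solvable:
  assumes s_pos: "\<And>k. k < N \<Longrightarrow> 0 < s k"
    and ran: "\<And>k. k < N \<Longrightarrow> EO k \<in> range (\<lambda>v. Cov k *v v)"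
  shows "\<exists>S Sc U p. solves_S_equations M N s e \<mu>1 S Sc U \<and> solves_\<pi>_equations M N s e \<mu>2 S Sc U p"
proof -
  \<comment> \<open>All four sequences are generated together. Since \<open>bbO\<close>,
    \<open>bbL\<close>, \<open>\<theta>\<close> and \<open>\<beta>\<close> at \<open>k\<close> read
    the sequences only at \<open>k + 1\<close>, constant functions can stand in for them.\<close>
  define f where "f = (\<lambda>k (S', Sc', U', p'). let EOk = EO k;
        Om = bbO M s e (\<lambda>_. S') (\<lambda>_. Sc') k;
        L = bbL M s e (\<lambda>_. Sc') (\<lambda>_. U') k;
        th = \<theta> M s e (\<lambda>_. p') k
      in (S' * ((s k)\<^sup>2 - 2 * s k * (EOk \<bullet> (pinv Om *v L)) + L \<bullet> ((pinv Om ** E2 k ** pinv Om) *v L)),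
          (s k)\<^sup>2 * Sc' - 2 * s k * Sc' * (EOk \<bullet> (pinv Om *v L)) + L \<bullet> (pinv Om *v L),
          (s k - EOk \<bullet> (pinv Om *v L)) * U',
          - (\<beta> M s e (\<lambda>_. S') (\<lambda>_. Sc') (\<lambda>_. U') k \<bullet> (pinv Om *v th))
            + (s k - EOk \<bullet> (pinv Om *v L)) * p'))"
  obtain r where r: "r N = (1, 0, - \<mu>1 / 2, - \<mu>2 / 2)" "\<And>k. k < N \<Longrightarrow> r k = f k (r (Suc k))"
    using backward_recursion[of N "(1, 0, - \<mu>1 / 2, - \<mu>2 / 2)" f] by blast
  define S where "S = (\<lambda>k. fst (r k))"
  define Sc where "Sc = (\<lambda>k. fst (snd (r k)))"
  define U where "U = (\<lambda>k. fst (snd (snd (r k))))"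
  define p where "p = (\<lambda>k. snd (snd (snd (r k))))"
  have r_eq: "r k = (S k, Sc k, U k, p k)" for k
    by (simp add: S_def Sc_def U_def p_def)
  have loc: "bbO M s e (\<lambda>_. S (Suc k)) (\<lambda>_. Sc (Suc k)) k = bbO M s e S Sc k"
    "bbL M s e (\<lambda>_. Sc (Suc k)) (\<lambda>_. U (Suc k)) k = bbL M s e Sc U k"
    "\<theta> M s e (\<lambda>_. p (Suc k)) k = \<theta> M s e p k"
    "\<beta> M s e (\<lambda>_. S (Suc k)) (\<lambda>_. Sc (Suc k)) (\<lambda>_. U (Suc k)) k = \<beta> M s e S Sc U k" for k
    by (simp_all add: bbO_def bbL_def \<theta>_def \<beta>_def)
  have rec: "S k = S (Suc k) * ((s k)\<^sup>2 - 2 * s k * (EO k \<bullet> (pinv (bbO M s e S Sc k) *v bbL M s e Sc U k))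
       + bbL M s e Sc U k \<bullet> ((pinv (bbO M s e S Sc k) ** E2 k ** pinv (bbO M s e S Sc k)) *v bbL M s e Sc U k))"
    "Sc k = (s k)\<^sup>2 * Sc (Suc k)
       - 2 * s k * Sc (Suc k) * (EO k \<bullet> (pinv (bbO M s e S Sc k) *v bbL M s e Sc U k))
       + bbL M s e Sc U k \<bullet> (pinv (bbO M s e S Sc k) *v bbL M s e Sc U k)"
    "U k = (s k - EO k \<bullet> (pinv (bbO M s e S Sc k) *v bbL M s e Sc U k)) * U (Suc k)"
    "p k = - (\<beta> M s e S Sc U k \<bullet> (pinv (bbO M s e S Sc k) *v \<theta> M s e p k))
       + (s k - EO k \<bullet> (pinv (bbO M s e S Sc k) *v bbL M s e Sc U k)) * p (Suc k)"
    if "k < N" for k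
    using r(2)[OF that] unfolding r_eq f_def by (simp_all only: prod.case Let_def loc prod.inject)
  \<comment> \<open>With \<open>v\<close> the feedback gain, \<open>S k = 0\<close> would force \<open>Cov k *v v = 0\<close>, hence \<open>EO k \<bullet> v = 0\<close> by the
    range condition, and then \<open>s k = 0\<close>.\<close>
  have pos: "0 < S k \<and> 0 \<le> Sc k" if "k \<le> N" for k
    using that
  proof (induction k rule: inc_induct)
    case base
    then show ?case using r(1) by (simp add: r_eq)
  next
    case (step k)
    let ?A = "bbO M s e S Sc k" and ?L = "bbL M s e Sc U k"
    have k: "k < N" and pos: "0 < S (Suc k)" "0 \<le> Sc (Suc k)" using step by auto
    note A = psd_bbO[OF k, of S Sc, OF pos ran[OF k]]
    have L: "?A *v (pinv ?A *v ?L) = ?L"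
      unfolding bbL_def by (rule bbO_pinv_mean_excess[of k S Sc, OF k pos ran[OF k]])
    define v where "v = - (pinv ?A *v ?L)"
    note inner = inner_bbL_pinv[OF A L, folded v_def] inner_bbL_sandwich[OF A L, folded v_def]
    have mv: "EO k \<bullet> (pinv ?A *v ?L) = - (EO k \<bullet> v)" by (simp add: v_def)
    define q where "q = v \<bullet> (Cov k *v v)"
    have q0: "0 \<le> q" using psd_cov_excess[OF k] by (simp add: psd_def q_def)
    have E2v: "v \<bullet> (E2 k *v v) = q + (EO k \<bullet> v)\<^sup>2"
      by (simp add: q_def cov_excess_eq[OF k] matrix_vector_mult_diff_rdistrib outer_mult_vec
          inner_diff_right power2_eq_square inner_commute[of v "EO k"])
    \<comment> \<open>In terms of the gain \<open>v\<close>, completing the square exhibits both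
      recursions as sums of nonnegative terms, with \<open>q\<close> the variance of the excess
      return along \<open>v\<close>.\<close>
    have S: "S k = S (Suc k) * ((s k + EO k \<bullet> v)\<^sup>2 + q)"
      unfolding rec(1)[OF k] inner mv E2v by (simp add: power2_eq_square algebra_simps)
    have Sc: "Sc k = Sc (Suc k) * (s k + EO k \<bullet> v)\<^sup>2 + S (Suc k) * q"
      unfolding rec(2)[OF k] inner mv bbO_inner[OF k] E2v by (simp add: power2_eq_square algebra_simps)
    have "0 < (s k + EO k \<bullet> v)\<^sup>2 + q"
    proof (cases "q = 0")
      case True
      then have "Cov k *v v = 0"
        using psd_null[OF psd_cov_excess[OF k]] by (simp add: q_def)
      moreover obtain w where "EO k = Cov k *v w" using ran[OF k] by blast
      ultimately have "EO k \<bullet> v = 0"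
        using psd_inner_commute[OF psd_cov_excess[OF k], of v w] by (simp add: inner_commute)
      then show ?thesis using s_pos[OF k] True by simp
    next
      case False
      then show ?thesis using q0 by (simp add: add_nonneg_pos)
    qed
    then show ?case using pos q0 by (simp add: S Sc)
  qed
  have constraints: "psd (bbO M s e S Sc k)"
    "(bbO M s e S Sc k ** pinv (bbO M s e S Sc k)) *v bbL M s e Sc U k = bbL M s e Sc U k"
    "(bbO M s e S Sc k ** pinv (bbO M s e S Sc k)) *v \<theta> M s e p k = \<theta> M s e p k" if "k < N" for k
    using psd_bbO[of k S Sc] bbO_pinv_mean_excess[of k S Sc] pos[of "Suc k"] ran that
    by (simp_all add: bbL_def \<theta>_def matrix_vector_mul_assoc[symmetric])
  have "solves_S_equations M N s e \<mu>1 S Sc U"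
    using r(1) rec(1-3) constraints unfolding solves_S_equations_def Let_def Suc_eq_plus1[symmetric] r_eq
    by blast
  moreover have "solves_\<pi>_equations M N s e \<mu>2 S Sc U p"
    using r(1) rec(4) constraints unfolding solves_\<pi>_equations_def Let_def Suc_eq_plus1[symmetric] r_eq
    by blast
  ultimately show ?thesis by blast
qed

text \<open>The solution is arbitrary: its constraints give positivity and the range conditions
  directly. The remaining moments of the closed loop are recovered from it, after which
  \<open>equilibrium_inequality\<close> applies at each stage.\<close>

lemma solution_linear_feedback_equilibrium:
  assumes "\<mu>1 \<noteq> 0"
    and solS: "solves_S_equations M N s e \<mu>1 S Sc U"
    and solp: "solves_\<pi>_equations M N s e \<mu>2 S Sc U p"
    and t: "t < N" and x: "x \<in> l2F M e t"
  shows "linear_feedback_equilibrium M N s e \<mu>1 \<mu>2 t x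
          (\<lambda>_ k. - (pinv (bbO M s e S Sc k) *v bbL M s e Sc U k))
          (\<lambda>_ k _. - (pinv (bbO M s e S Sc k) *v \<theta> M s e p k))"
proof -
  define \<Psi> where "\<Psi> = (\<lambda>k. - (pinv (bbO M s e S Sc k) *v bbL M s e Sc U k))"
  define \<gamma> where "\<gamma> = (\<lambda>k. - (pinv (bbO M s e S Sc k) *v \<theta> M s e p k))"
  \<comment> \<open>Inverts \<open>U = - \<mu>1 / 2 * E A\<close>, which is where
    \<open>\<mu>1 \<noteq> 0\<close> enters.\<close>
  define a where "a = (\<lambda>k. - 2 / \<mu>1 * U k)"
  have psd: "psd (bbO M s e S Sc k)"
    and L: "bbO M s e S Sc k *v (pinv (bbO M s e S Sc k) *v bbL M s e Sc U k) = bbL M s e Sc U k"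
    and th: "bbO M s e S Sc k *v (pinv (bbO M s e S Sc k) *v \<theta> M s e p k) = \<theta> M s e p k"
    if "k < N" for k
    using solS solp that
    by (simp_all add: solves_S_equations_def solves_\<pi>_equations_def Let_def matrix_vector_mul_assoc)
  have m\<Psi>: "EO k \<bullet> (pinv (bbO M s e S Sc k) *v bbL M s e Sc U k) = - (EO k \<bullet> \<Psi> k)" for k
    by (simp add: \<Psi>_def)
  note inner = inner_bbL_pinv[OF psd L] inner_bbL_sandwich[OF psd L] inner_\<beta>[OF psd L]
  have S: "S k = S (Suc k) * ((s k)\<^sup>2 + 2 * s k * (EO k \<bullet> \<Psi> k) + \<Psi> k \<bullet> (E2 k *v \<Psi> k))"
    and Sc: "Sc k = (s k)\<^sup>2 * Sc (Suc k) + 2 * s k * Sc (Suc k) * (EO k \<bullet> \<Psi> k)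
      + \<Psi> k \<bullet> (bbO M s e S Sc k *v \<Psi> k)"
    and U: "U k = (s k + EO k \<bullet> \<Psi> k) * U (Suc k)"
    and p: "p k = s k * Sc (Suc k) * (EO k \<bullet> \<gamma> k) + \<Psi> k \<bullet> (bbO M s e S Sc k *v \<gamma> k)
      + (s k + EO k \<bullet> \<Psi> k) * p (Suc k)" if k: "k < N" for k
  proof -
    note eqs = solS[unfolded solves_S_equations_def Let_def Suc_eq_plus1[symmetric],
        THEN conjunct1, rule_format, OF k]
    note eqp = solp[unfolded solves_\<pi>_equations_def Let_def Suc_eq_plus1[symmetric],
        THEN conjunct1, rule_format, OF k]
    show "S k = S (Suc k) * ((s k)\<^sup>2 + 2 * s k * (EO k \<bullet> \<Psi> k) + \<Psi> k \<bullet> (E2 k *v \<Psi> k))"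
      using eqs[THEN conjunct1] unfolding inner(2)[OF k k] m\<Psi> by (simp add: \<Psi>_def)
    show "Sc k = (s k)\<^sup>2 * Sc (Suc k) + 2 * s k * Sc (Suc k) * (EO k \<bullet> \<Psi> k)
      + \<Psi> k \<bullet> (bbO M s e S Sc k *v \<Psi> k)"
      using eqs[THEN conjunct2, THEN conjunct1] unfolding inner(1)[OF k k] m\<Psi> by (simp add: \<Psi>_def)
    show "U k = (s k + EO k \<bullet> \<Psi> k) * U (Suc k)"
      using eqs[THEN conjunct2, THEN conjunct2, THEN conjunct1] unfolding m\<Psi> by simp
    show "p k = s k * Sc (Suc k) * (EO k \<bullet> \<gamma> k) + \<Psi> k \<bullet> (bbO M s e S Sc k *v \<gamma> k)
      + (s k + EO k \<bullet> \<Psi> k) * p (Suc k)"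
      using eqp[THEN conjunct1] unfolding inner(3)[OF k k] m\<Psi> by (simp add: \<Psi>_def \<gamma>_def)
  qed
  have N: "S N = 1" "Sc N = 0" "U N = - \<mu>1 / 2" "p N = - \<mu>2 / 2"
    using solS solp by (auto simp: solves_S_equations_def solves_\<pi>_equations_def)
  have aU: "U k = - \<mu>1 / 2 * a k" for k using assms(1) by (simp add: a_def)
  have a: "a k = a (Suc k) * (s k + EO k \<bullet> \<Psi> k)" if "k < N" for k
    using U[OF that] by (simp add: a_def)
  have aN: "a N = 1" using N assms(1) by (simp add: a_def)
  \<comment> \<open>Second moment equals variance plus squared mean, here derived from the
    recursions alone.\<close>
  have var: "S k = Sc k + (a k)\<^sup>2" if "k \<le> N" for k
    using that
  proof (induction k rule: inc_induct)
    case base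
    then show ?case by (simp add: N aN)
  next
    case (step k)
    then have k: "k < N" by simp
    show ?case
      unfolding S[OF k] Sc[OF k] a[OF k] bbO_inner[OF k] step.IH
      by (simp add: power2_eq_square algebra_simps)
  qed
  obtain b where b: "b N = 0" "\<And>k. k < N \<Longrightarrow> b k = a (Suc k) * (EO k \<bullet> \<gamma> k) + b (Suc k)"
    using backward_recursion[of N 0 "\<lambda>k b'. a (Suc k) * (EO k \<bullet> \<gamma> k) + b'"] by blast
  \<comment> \<open>\<open>E (A B)\<close> is the covariance plus the product of means, and the
    covariance is \<open>p + \<mu>2 / 2 * a\<close>.\<close>
  define g where "g = (\<lambda>k. p k + \<mu>2 / 2 * a k + a k * b k)"
  obtain h where h: "h N = 0" "\<And>k. k < N \<Longrightarrow> h k = S (Suc k) * (\<gamma> k \<bullet> (E2 k *v \<gamma> k))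
      + 2 * g (Suc k) * (EO k \<bullet> \<gamma> k) + h (Suc k)"
    using backward_recursion[of N 0 "\<lambda>k h'. S (Suc k) * (\<gamma> k \<bullet> (E2 k *v \<gamma> k))
      + 2 * g (Suc k) * (EO k \<bullet> \<gamma> k) + h'"] by blast
  \<comment> \<open>Only the recursion for \<open>g\<close> is not immediate: expanding
    \<open>bbO\<close> in the recursion for \<open>p\<close> gives it once \<open>var\<close> trades
    \<open>S\<close> for \<open>Sc + a\<^sup>2\<close>.\<close>
  interpret affine_feedback M N s e \<Psi> \<gamma> a b S g h
  proof
    fix k assume k: "k < N"
    show "g k = S (Suc k) * (s k * (EO k \<bullet> \<gamma> k) + \<Psi> k \<bullet> (E2 k *v \<gamma> k))
      + g (Suc k) * (s k + EO k \<bullet> \<Psi> k)"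
      using k unfolding g_def p[OF k] a[OF k] b(2)[OF k] bbO_inner[OF k]
      by (simp add: var power2_eq_square algebra_simps)
  qed (use a aN b S N h in \<open>simp_all add: g_def\<close>)
  define \<psi> where "\<psi> = (\<lambda>k \<xi> (\<omega> :: 'a). \<xi> \<omega> *\<^sub>R \<Psi> k + \<gamma> k :: real^'m)"
  have mem: "closed_wealth s e t x \<psi> k \<in> l2F M e k" if "t \<le> k" "k \<le> N" for k
    using closed_loop_moments(1)[of "closed_wealth s e t x \<psi>" t k] that x
    by (simp add: closed_wealth_start \<psi>_def)
  have "AE \<omega> in M. cost M N s e \<mu>1 \<mu>2 k (closed_wealth s e t x \<psi> k)
        (closed_control s e k (closed_wealth s e t x \<psi> k) \<psi>) \<omega>
      \<le> cost M N s e \<mu>1 \<mu>2 k (closed_wealth s e t x \<psi> k)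
        (closed_control s e k (closed_wealth s e t x \<psi> k) (\<psi>(k := \<lambda>_. u))) \<omega>"
    if k: "t \<le> k" "k < N" and u: "u \<in> l2F M e k" for k u
  proof (rule equilibrium_inequality[OF k(2) mem u psd[OF k(2)], where Sc = "Sc (Suc k)"])
    show "bbO M s e S Sc k *v \<Psi> k = - ((s k * Sc (Suc k) - \<mu>1 / 2 * a (Suc k)) *\<^sub>R EO k)"
      by (simp add: \<Psi>_def matrix_vector_mult_minus L[OF k(2)]) (simp add: bbL_def aU)
    show "bbO M s e S Sc k *v \<gamma> k
        = - ((g (Suc k) - a (Suc k) * b (Suc k) - \<mu>2 / 2 * a (Suc k)) *\<^sub>R EO k)"
      by (simp add: \<gamma>_def matrix_vector_mult_minus th[OF k(2)]) (simp add: \<theta>_def g_def)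
  qed (use k in \<open>auto simp: bbO_def var \<psi>_def\<close>)
  then have "feedback_equilibrium M N s e \<mu>1 \<mu>2 t x (\<lambda>_. \<psi>)"
    unfolding feedback_equilibrium_def feedback_strategies_def Let_def
    by (auto simp: \<psi>_def intro!: l2F_add l2F_scaleR l2F_const)
  then show ?thesis
    unfolding linear_feedback_equilibrium_def \<psi>_def \<Psi>_def \<gamma>_def l2F_process_def
    by (simp add: l2F_const)
qed

end

text \<open>The equations determine a solution only at indices up to \<open>N\<close>. Existence is
  stated once and the equilibrium claim for every solution, so no values beyond \<open>N\<close>
  have to be chosen.\<close>

theorem theorem3p4:
  fixes M :: "'a measure"
    and N :: nat
    and s :: "nat \<Rightarrow> real"
    and e :: "nat \<Rightarrow> 'a \<Rightarrow> real^'m"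
    and \<mu>1 \<mu>2 :: real
  assumes "prob_space M"
    and "N \<ge> 1"
    and "\<And>k. k < N \<Longrightarrow> s k > 1"
    and "\<And>k. k < N \<Longrightarrow> e k \<in> borel_measurable M"
    and "\<And>k. k < N \<Longrightarrow> integrable M (\<lambda>\<omega>. (norm (e k \<omega>))\<^sup>2)"
    and "prob_space.indep_vars M (\<lambda>_. borel) e {..<N}"
    and "\<mu>1 > 0" and "\<mu>2 > 0"
    and "\<And>k. k < N \<Longrightarrow> mean_excess M s e k \<in> range (\<lambda>v. cov_excess M s e k *v v)"
  shows "(\<exists>S Sc U p. solves_S_equations M N s e \<mu>1 S Sc U \<and> solves_\<pi>_equations M N s e \<mu>2 S Sc U p) \<and>
    (\<forall>S Sc U p. solves_S_equations M N s e \<mu>1 S Sc U \<longrightarrow> solves_\<pi>_equations M N s e \<mu>2 S Sc U p \<longrightarrow>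
      (\<forall>t<N. \<forall>x\<in>l2F M e t.
        linear_feedback_equilibrium M N s e \<mu>1 \<mu>2 t x
          (\<lambda>_ k. - (pinv (bbO M s e S Sc k) *v bbL M s e Sc U k))
          (\<lambda>_ k _. - (pinv (bbO M s e S Sc k) *v \<theta> M s e p k))))"
proof -
  interpret prob_space M by fact
  interpret market M N s e
    by unfold_locales (use assms(4-6) in auto)
  have "0 < s k" if "k < N" for k using assms(3)[OF that] by simp
  with assms(9) have "\<exists>S Sc U p. solves_S_equations M N s e \<mu>1 S Sc U \<and>
      solves_\<pi>_equations M N s e \<mu>2 S Sc U p"
    by (intro difference_equations_solvable)
  moreover have "\<mu>1 \<noteq> 0" using assms(7) by simp
  ultimately show ?thesis
    using solution_linear_feedback_equilibrium by blast
qed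

end
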